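(* (a) Let $\lambda \in k^\times$ be such that $\lambda \neq \epsilon q^n$ for all $n \in \mathbb{N}_0$ and $\epsilon\in\{1,-1\}$. Then the Verma module $M(\lambda)$ is self-dual, i.e. $M(\lambda)^\sigma \cong M(\lambda)$ as $U_q$-modules. (b) For every $n \in \mathbb{N}_0$ and $\epsilon\in\{1,-1\}$, the $T$ module $T(n,\epsilon)$ is self-dual, i.e. $T(n,\epsilon)^\sigma \cong T(n,\epsilon)$ as $U_q$-modules.
   Context: Let $k$ be a field with $\operatorname{char} k \neq 2,3$ and let $q \in k$, $q\neq 0$, be not a root of unity. $\mathbb{N}_0=\{0,1,2,\dots\}$, $k^\times=k\smallsetminus\{0\}$. $U_q=U_q(sl_2)$ is the associative unital $k$-algebra with generators $e,f,t,t^{-1}$ and relations $tt^{-1}=1=t^{-1}t$, $tet^{-1}=q^2e$, $tft^{-1}=q^{-2}f$, $ef-fe=\frac{t-t^{-1}}{q-q^{-1}}$. For $m\in\mathbb{Z}$ put $[m]=\frac{q^m-q^{-m}}{q-q^{-1}}$. The quantum Casimir element is $C=\frac{qt+q^{-1}t^{-1}}{(q-q^{-1})^2}+fe$. For $n\in\mathbb{N}_0$ and $\epsilon=\pm1$ let $c=\frac{q^{n+1}+q^{-n-1}}{(q-q^{-1})^2}$, let $I(n,\epsilon)=U_q\{t-\epsilon q^{-n-2},\, e^{n+2},\,(C-\epsilon c)^2\}$ be the left ideal generated by the listed elements, and let $T(n,\epsilon)=U_q/I(n,\epsilon)$, a left $U_q$-module (a "$T$ module"). For $\lambda\in k^\times$,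 $M(\lambda)$ is the Verma module of highest weight $\lambda$: the $U_q$-module with $k$-basis $\{v_i\}_{i\ge0}$ and action $tv_i=q^{-2i}\lambda v_i$, $fv_i=v_{i+1}$, $ev_i=[i]\frac{q^{1-i}\lambda-q^{i-1}\lambda^{-1}}{q-q^{-1}}v_{i-1}$ (with $v_{-1}=0$). For a $U_q$-module $M$ and $\omega\in k^\times$ let $M_\omega=\{m\in M\mid tm=\omega m\}$; $M$ is a weight module if $M=\bigoplus_\omega M_\omega$. The category $\mathcal{O}(U_q(sl_2))$ consists of the weight modules $M$ with all $\dim M_\omega<\infty$ whose weights lie in a finite union of cones $D(x)=\{q^{-2m}x\mid m\in\mathbb{N}_0\}$, $x\in k^\times$; Verma modules and $T$ modules belong to it. For $M$ in $\mathcal{O}(U_q(sl_2))$, the restricted dual is $M^{res}=\{\phi\in \operatorname{Hom}_k(M,k)\mid \phi(M_\omega)=0 \text{ for all but finitely many weights } \omega \text{ of } M\}$. Let $\sigma$ be the involutory antiautomorphism of $U_q$ with $\sigma(e)=f$, $\sigma(f)=e$, $\sigma(t)=t$. $M^\sigma$ denotes $M^{res}$ with the $U_q$-action $(u\phi)(m)=\phi(\sigma(u)m)$ for $u\in U_q$, $\phi\in M^{res}$, $m\in M$. *)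

theory Defs
  imports "HOL-Algebra.Algebra" "HOL-Library.Poly_Mapping"
begin

section \<open>Free vector spaces and linear extension\<close>

definition pm_scale :: "'k::field \<Rightarrow> ('a \<Rightarrow>\<^sub>0 'k) \<Rightarrow> ('a \<Rightarrow>\<^sub>0 'k)" where
  "pm_scale c p = Poly_Mapping.map ((*) c) p"

definition pm_extend :: "('a \<Rightarrow> ('b \<Rightarrow>\<^sub>0 'k)) \<Rightarrow> ('a \<Rightarrow>\<^sub>0 'k::field) \<Rightarrow> ('b \<Rightarrow>\<^sub>0 'k)" where
  "pm_extend b p = (\<Sum>i\<in>Poly_Mapping.keys p. pm_scale (Poly_Mapping.lookup p i) (b i))"


section \<open>Left ideals and left modules over noncommutative rings\<close>

definition left_ideal :: "'a set \<Rightarrow> ('a, 'm) ring_scheme \<Rightarrow> bool" where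
  "left_ideal I R \<longleftrightarrow>
     additive_subgroup I R \<and> (\<forall>a\<in>I. \<forall>x\<in>carrier R. x \<otimes>\<^bsub>R\<^esub> a \<in> I)"

definition gen_left_ideal :: "('a, 'm) ring_scheme \<Rightarrow> 'a set \<Rightarrow> 'a set" where
  "gen_left_ideal R S = \<Inter>{I. left_ideal I R \<and> S \<subseteq> I}"

text \<open>As for \<^locale>\<open>module\<close>, the fields \<^const>\<open>mult\<close> and \<^const>\<open>one\<close> of the record \<^typ>\<open>('a, 'b) module\<close>
  play no role; only the assumption that the ring is commutative is dropped.\<close>

locale left_module = R?: ring R + M?: abelian_group M
  for R :: "('a, 'r) ring_scheme" and M :: "('a, 'b, 'm) module_scheme" +
  assumes smult_closed:
      "\<lbrakk>a \<in> carrier R; x \<in> carrier M\<rbrakk> \<Longrightarrow> a \<odot>\<^bsub>M\<^esub> x \<in> carrier M"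
    and smult_l_distr:
      "\<lbrakk>a \<in> carrier R; b \<in> carrier R; x \<in> carrier M\<rbrakk> \<Longrightarrow>
       (a \<oplus>\<^bsub>R\<^esub> b) \<odot>\<^bsub>M\<^esub> x = a \<odot>\<^bsub>M\<^esub> x \<oplus>\<^bsub>M\<^esub> b \<odot>\<^bsub>M\<^esub> x"
    and smult_r_distr:
      "\<lbrakk>a \<in> carrier R; x \<in> carrier M; y \<in> carrier M\<rbrakk> \<Longrightarrow>
       a \<odot>\<^bsub>M\<^esub> (x \<oplus>\<^bsub>M\<^esub> y) = a \<odot>\<^bsub>M\<^esub> x \<oplus>\<^bsub>M\<^esub> a \<odot>\<^bsub>M\<^esub> y"
    and smult_assoc:
      "\<lbrakk>a \<in> carrier R; b \<in> carrier R; x \<in> carrier M\<rbrakk> \<Longrightarrow>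
       (a \<otimes>\<^bsub>R\<^esub> b) \<odot>\<^bsub>M\<^esub> x = a \<odot>\<^bsub>M\<^esub> (b \<odot>\<^bsub>M\<^esub> x)"
    and smult_one: "x \<in> carrier M \<Longrightarrow> \<one>\<^bsub>R\<^esub> \<odot>\<^bsub>M\<^esub> x = x"

definition left_module_iso ::
  "('a, 'r) ring_scheme \<Rightarrow> ('a, 'b) module \<Rightarrow> ('a, 'c) module \<Rightarrow> ('b \<Rightarrow> 'c) set" where
  "left_module_iso R M N =
     {h. bij_betw h (carrier M) (carrier N) \<and>
         (\<forall>x\<in>carrier M. \<forall>y\<in>carrier M. h (x \<oplus>\<^bsub>M\<^esub> y) = h x \<oplus>\<^bsub>N\<^esub> h y) \<and>
         (\<forall>r\<in>carrier R. \<forall>x\<in>carrier M. h (r \<odot>\<^bsub>M\<^esub> x) = r \<odot>\<^bsub>N\<^esub> h x)}"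

definition isomorphic_left_modules ::
  "('a, 'r) ring_scheme \<Rightarrow> ('a, 'b) module \<Rightarrow> ('a, 'c) module \<Rightarrow> bool" where
  "isomorphic_left_modules R M N \<longleftrightarrow>
     left_module R M \<and> left_module R N \<and> left_module_iso R M N \<noteq> {}"

definition quotient_left_module :: "('a, 'r) ring_scheme \<Rightarrow> 'a set \<Rightarrow> ('a, 'a set) module" where
  "quotient_left_module R I =
     \<lparr>carrier = a_rcosets\<^bsub>R\<^esub> I, monoid.mult = undefined, one = undefined,
      ring.zero = I, add = set_add R,
      smult = (\<lambda>r A. \<Union>x\<in>A. I +>\<^bsub>R\<^esub> (r \<otimes>\<^bsub>R\<^esub> x))\<rparr>"


section \<open>The quantum group\<close>

datatype uq_gen = Gen_e | Gen_f | Gen_t | Gen_tinv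

datatype uq_word = Word (letters: "uq_gen list")

text \<open>The free monoid on the four generators, written additively so that
  \<^typ>\<open>uq_word \<Rightarrow>\<^sub>0 'k\<close>, with the convolution product of \<^theory>\<open>HOL-Library.Poly_Mapping\<close>,
  is the free associative unital algebra.\<close>

instantiation uq_word :: monoid_add
begin
definition "0 = Word []"
definition "v + w = Word (letters v @ letters w)"
instance by standard (simp_all add: zero_uq_word_def plus_uq_word_def)
end

type_synonym 'k free_alg = "uq_word \<Rightarrow>\<^sub>0 'k"

abbreviation gen :: "uq_gen \<Rightarrow> 'k::field free_alg" where
  "gen g \<equiv> Poly_Mapping.single (Word [g]) 1"

abbreviation const :: "'k::field \<Rightarrow> 'k free_alg" where
  "const c \<equiv> Poly_Mapping.single 0 c"

definition free_alg_ring :: "'k::field free_alg ring" where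
  "free_alg_ring = \<lparr>carrier = UNIV, monoid.mult = (*), one = 1, ring.zero = 0, add = (+)\<rparr>"

definition uq_relators :: "'k::field \<Rightarrow> 'k free_alg set" where
  "uq_relators q =
     {gen Gen_t * gen Gen_tinv - 1,
      gen Gen_tinv * gen Gen_t - 1,
      gen Gen_t * gen Gen_e * gen Gen_tinv - const (q\<^sup>2) * gen Gen_e,
      gen Gen_t * gen Gen_f * gen Gen_tinv - const (inverse (q\<^sup>2)) * gen Gen_f,
      gen Gen_e * gen Gen_f - gen Gen_f * gen Gen_e
        - const (1 / (q - inverse q)) * (gen Gen_t - gen Gen_tinv)}"

definition uq_ideal :: "'k::field \<Rightarrow> 'k free_alg set" where
  "uq_ideal q = genideal free_alg_ring (uq_relators q)"

definition Uq :: "'k::field \<Rightarrow> 'k free_alg set ring" where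
  "Uq q = free_alg_ring Quot (uq_ideal q)"

definition uq_class :: "'k::field \<Rightarrow> 'k free_alg \<Rightarrow> 'k free_alg set" where
  "uq_class q x = uq_ideal q +>\<^bsub>free_alg_ring\<^esub> x"

definition quantum_int :: "'k::field \<Rightarrow> int \<Rightarrow> 'k" where
  "quantum_int q m = (q powi m - q powi (- m)) / (q - inverse q)"

text \<open>A representative in the free algebra of the quantum Casimir element.\<close>

definition casimir :: "'k::field \<Rightarrow> 'k free_alg" where
  "casimir q = const (1 / (q - inverse q)\<^sup>2) * (const q * gen Gen_t + const (inverse q) * gen Gen_tinv)
     + gen Gen_f * gen Gen_e"


section \<open>Verma modules and T modules\<close>

fun verma_gen :: "'k::field \<Rightarrow> 'k \<Rightarrow> uq_gen \<Rightarrow> nat \<Rightarrow> (nat \<Rightarrow>\<^sub>0 'k)" where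
  "verma_gen q l Gen_e i =
     (if i = 0 then 0 else
      Poly_Mapping.single (i - 1)
       (quantum_int q (int i) *
         ((q powi (1 - int i) * l - q powi (int i - 1) * inverse l) / (q - inverse q))))"
| "verma_gen q l Gen_f i = Poly_Mapping.single (Suc i) 1"
| "verma_gen q l Gen_t i = Poly_Mapping.single i (q powi (- 2 * int i) * l)"
| "verma_gen q l Gen_tinv i = Poly_Mapping.single i (inverse (q powi (- 2 * int i) * l))"

definition verma_word :: "'k::field \<Rightarrow> 'k \<Rightarrow> uq_word \<Rightarrow> (nat \<Rightarrow>\<^sub>0 'k) \<Rightarrow> (nat \<Rightarrow>\<^sub>0 'k)" where
  "verma_word q l w p = foldr (\<lambda>g. pm_extend (verma_gen q l g)) (letters w) p"

definition verma_free :: "'k::field \<Rightarrow> 'k \<Rightarrow> 'k free_alg \<Rightarrow> (nat \<Rightarrow>\<^sub>0 'k) \<Rightarrow> (nat \<Rightarrow>\<^sub>0 'k)" where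
  "verma_free q l x p = pm_extend (\<lambda>w. verma_word q l w p) x"

text \<open>An element of \<^term>\<open>Uq q\<close> is a coset; it acts through any of its representatives
  (see \<open>verma_smult_class\<close> below).\<close>

definition verma :: "'k::field \<Rightarrow> 'k \<Rightarrow> ('k free_alg set, nat \<Rightarrow>\<^sub>0 'k) module" where
  "verma q l =
     \<lparr>carrier = UNIV, monoid.mult = undefined, one = undefined, ring.zero = 0, add = (+),
      smult = (\<lambda>u p. the_elem ((\<lambda>x. verma_free q l x p) ` u))\<rparr>"

definition T_casimir_value :: "'k::field \<Rightarrow> nat \<Rightarrow> 'k" where
  "T_casimir_value q n =
     (q powi (int n + 1) + q powi (- int n - 1)) / (q - inverse q)\<^sup>2"

definition T_ideal :: "'k::field \<Rightarrow> nat \<Rightarrow> 'k \<Rightarrow> 'k free_alg set set" where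
  "T_ideal q n \<epsilon> = gen_left_ideal (Uq q)
     {uq_class q (gen Gen_t - const (\<epsilon> * q powi (- int n - 2))),
      uq_class q (gen Gen_e ^ (n + 2)),
      uq_class q ((casimir q - const (\<epsilon> * T_casimir_value q n))\<^sup>2)}"

definition T_module :: "'k::field \<Rightarrow> nat \<Rightarrow> 'k \<Rightarrow> ('k free_alg set, 'k free_alg set set) module" where
  "T_module q n \<epsilon> = quotient_left_module (Uq q) (T_ideal q n \<epsilon>)"


section \<open>Restricted duals\<close>

definition weight_space :: "'k::field \<Rightarrow> ('k free_alg set, 'm) module \<Rightarrow> 'k \<Rightarrow> 'm set" where
  "weight_space q M \<omega> =
     {m \<in> carrier M. uq_class q (gen Gen_t) \<odot>\<^bsub>M\<^esub> m = uq_class q (const \<omega>) \<odot>\<^bsub>M\<^esub> m}"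

definition weights :: "'k::field \<Rightarrow> ('k free_alg set, 'm) module \<Rightarrow> 'k set" where
  "weights q M = {\<omega>. \<omega> \<noteq> 0 \<and> weight_space q M \<omega> \<noteq> {\<zero>\<^bsub>M\<^esub>}}"

text \<open>The action of the field on a module over \<^term>\<open>Uq q\<close> is that of the constants of
  \<^term>\<open>Uq q\<close>. Functionals are extensional so that they are determined by their values
  on the carrier.\<close>

definition linear_functionals :: "'k::field \<Rightarrow> ('k free_alg set, 'm) module \<Rightarrow> ('m \<Rightarrow> 'k) set" where
  "linear_functionals q M =
     {\<phi> \<in> extensional (carrier M).
        (\<forall>x\<in>carrier M. \<forall>y\<in>carrier M. \<phi> (x \<oplus>\<^bsub>M\<^esub> y) = \<phi> x + \<phi> y) \<and>
        (\<forall>c. \<forall>x\<in>carrier M. \<phi> (uq_class q (const c) \<odot>\<^bsub>M\<^esub> x) = c * \<phi> x)}"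

definition restricted_dual :: "'k::field \<Rightarrow> ('k free_alg set, 'm) module \<Rightarrow> ('m \<Rightarrow> 'k) set" where
  "restricted_dual q M =
     {\<phi> \<in> linear_functionals q M.
        finite {\<omega> \<in> weights q M. \<not> (\<forall>m\<in>weight_space q M \<omega>. \<phi> m = 0)}}"

fun sigma_gen :: "uq_gen \<Rightarrow> uq_gen" where
  "sigma_gen Gen_e = Gen_f"
| "sigma_gen Gen_f = Gen_e"
| "sigma_gen Gen_t = Gen_t"
| "sigma_gen Gen_tinv = Gen_tinv"

definition sigma_word :: "uq_word \<Rightarrow> uq_word" where
  "sigma_word w = Word (rev (map sigma_gen (letters w)))"

definition sigma_free :: "'k::field free_alg \<Rightarrow> 'k free_alg" where
  "sigma_free x = pm_extend (\<lambda>w. Poly_Mapping.single (sigma_word w) 1) x"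

text \<open>The antiautomorphism of \<^term>\<open>Uq q\<close> induced on cosets; see \<open>sigma_class\<close> below.\<close>

definition sigma :: "'k::field free_alg set \<Rightarrow> 'k free_alg set" where
  "sigma u = sigma_free ` u"

definition sigma_dual ::
  "'k::field \<Rightarrow> ('k free_alg set, 'm) module \<Rightarrow> ('k free_alg set, 'm \<Rightarrow> 'k) module" where
  "sigma_dual q M =
     \<lparr>carrier = restricted_dual q M, monoid.mult = undefined, one = undefined,
      ring.zero = restrict (\<lambda>m. 0) (carrier M),
      add = (\<lambda>\<phi> \<psi>. restrict (\<lambda>m. \<phi> m + \<psi> m) (carrier M)),
      smult = (\<lambda>u \<phi>. restrict (\<lambda>m. \<phi> (sigma u \<odot>\<^bsub>M\<^esub> m)) (carrier M))\<rparr>"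

section \<open>The constructions are well defined\<close>

lemma lookup_pm_scale [simp]:
  "Poly_Mapping.lookup (pm_scale c p) i = c * Poly_Mapping.lookup p i"
  by (simp add: pm_scale_def Poly_Mapping.map.rep_eq when_def)

lemma pm_scale_add: "pm_scale c (p + p') = pm_scale c p + pm_scale c p'"
  by (rule poly_mapping_eqI) (simp add: lookup_add algebra_simps)

lemma pm_scale_add_left: "pm_scale (c + d) p = pm_scale c p + pm_scale d p"
  by (rule poly_mapping_eqI) (simp add: lookup_add algebra_simps)

lemma pm_scale_diff: "pm_scale c (p - p') = pm_scale c p - pm_scale c p'"
  by (rule poly_mapping_eqI) (simp add: lookup_minus algebra_simps)

lemma pm_scale_scale: "pm_scale c (pm_scale d p) = pm_scale (c * d) p"
  by (rule poly_mapping_eqI) (simp add: algebra_simps)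

lemma pm_scale_simps [simp]: "pm_scale 0 p = 0" "pm_scale c 0 = 0" "pm_scale 1 p = p"
  by (rule poly_mapping_eqI; simp)+

lemma pm_scale_single [simp]: "pm_scale c (Poly_Mapping.single i d) = Poly_Mapping.single i (c * d)"
  by (rule poly_mapping_eqI) (simp add: lookup_single when_def)

lemma pm_scale_sum: "pm_scale c (sum f A) = (\<Sum>i\<in>A. pm_scale c (f i))"
  by (rule poly_mapping_eqI) (simp add: lookup_sum sum_distrib_left)

lemma pm_extend_superset:
  assumes "finite A" "Poly_Mapping.keys p \<subseteq> A"
  shows "pm_extend b p = (\<Sum>i\<in>A. pm_scale (Poly_Mapping.lookup p i) (b i))"
  unfolding pm_extend_def using assms
  by (intro sum.mono_neutral_left) (auto simp: in_keys_iff)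

lemma pm_extend_add: "pm_extend b (p + p') = pm_extend b p + pm_extend b p'"
proof -
  let ?A = "Poly_Mapping.keys p \<union> Poly_Mapping.keys p'"
  show ?thesis
    using pm_extend_superset[of ?A "p + p'" b] pm_extend_superset[of ?A p b]
      pm_extend_superset[of ?A p' b] Poly_Mapping.keys_add[of p p']
    by (simp add: lookup_add pm_scale_add_left sum.distrib)
qed

lemma pm_extend_single [simp]: "pm_extend b (Poly_Mapping.single i c) = pm_scale c (b i)"
  by (subst pm_extend_superset[of "{i}"]) auto

lemma pm_extend_0 [simp]: "pm_extend b 0 = 0"
  by (simp add: pm_extend_def)

lemma pm_extend_scale: "pm_extend b (pm_scale c p) = pm_scale c (pm_extend b p)"
proof -
  have "Poly_Mapping.keys (pm_scale c p) \<subseteq> Poly_Mapping.keys p"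
    by (auto simp: in_keys_iff)
  then show ?thesis
    using pm_extend_superset[of "Poly_Mapping.keys p" "pm_scale c p" b]
    by (simp add: pm_extend_def pm_scale_sum pm_scale_scale)
qed

lemma pm_extend_minus: "pm_extend b (p - p') = pm_extend b p - pm_extend b p'"
  using pm_extend_add[of b "p - p'" p'] by (simp add: algebra_simps)

lemma pm_extend_uminus: "pm_extend b (- p) = - pm_extend b p"
  using pm_extend_minus[of b 0 p] by simp

lemma pm_induct [case_names single add]:
  assumes "\<And>i c. P (Poly_Mapping.single i c)" "\<And>x y. P x \<Longrightarrow> P y \<Longrightarrow> P (x + y)"
  shows "P (p :: 'a \<Rightarrow>\<^sub>0 'k::field)"
proof -
  have eq: "p = pm_extend (\<lambda>i. Poly_Mapping.single i 1) p"
    by (rule poly_mapping_eqI)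
      (auto simp: pm_extend_def lookup_sum lookup_single in_keys_iff when_def sum.delta')
  have "P (\<Sum>i\<in>A. Poly_Mapping.single i (Poly_Mapping.lookup p i))" if "finite A" for A
    using that by (induction A) (use assms(1)[of _ 0] in \<open>auto intro: assms\<close>)
  then show ?thesis
    by (subst eq) (simp add: pm_extend_def)
qed

subsection \<open>The quotient ring\<close>

lemma free_alg_ring_simps [simp]:
  "carrier free_alg_ring = UNIV" "x \<otimes>\<^bsub>free_alg_ring\<^esub> y = x * y" "x \<oplus>\<^bsub>free_alg_ring\<^esub> y = x + y"
  "\<one>\<^bsub>free_alg_ring\<^esub> = 1" "\<zero>\<^bsub>free_alg_ring\<^esub> = 0"
  by (simp_all add: free_alg_ring_def)

lemma ring_free_alg_ring: "ring (free_alg_ring :: 'k::field free_alg ring)"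
proof -
  have "\<exists>y. x + y = 0" for x :: "'k free_alg"
    using add.right_inverse by blast
  then show ?thesis
    unfolding free_alg_ring_def
    by unfold_locales (auto simp: algebra_simps Units_def)
qed

lemma ideal_uq_ideal: "ideal (uq_ideal q) free_alg_ring"
  unfolding uq_ideal_def by (rule ring.genideal_ideal[OF ring_free_alg_ring]) simp

lemma ring_Uq: "ring (Uq q)"
  unfolding Uq_def by (rule ideal.quotient_is_ring[OF ideal_uq_ideal])

lemma uq_class_altdef: "uq_class q x = {y + x | y. y \<in> uq_ideal q}"
  by (auto simp: uq_class_def a_r_coset_def')

lemma carrier_Uq: "carrier (Uq q) = range (uq_class q)"
  by (auto simp: Uq_def FactRing_def A_RCOSETS_def' uq_class_def)

lemma Uq_class_simps:
  "uq_class q x \<oplus>\<^bsub>Uq q\<^esub> uq_class q y = uq_class q (x + y)"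
  "uq_class q x \<otimes>\<^bsub>Uq q\<^esub> uq_class q y = uq_class q (x * y)"
  "\<one>\<^bsub>Uq q\<^esub> = uq_class q 1"
  using ring_hom_add[OF ideal.rcos_ring_hom[OF ideal_uq_ideal[of q]], of x y]
    ring_hom_mult[OF ideal.rcos_ring_hom[OF ideal_uq_ideal[of q]], of x y]
    ring_hom_one[OF ideal.rcos_ring_hom[OF ideal_uq_ideal[of q]]]
  by (simp_all add: Uq_def uq_class_def)

lemma uq_ideal_closed:
  "0 \<in> uq_ideal q"
  "x \<in> uq_ideal q \<Longrightarrow> y \<in> uq_ideal q \<Longrightarrow> x + y \<in> uq_ideal q"
  "x \<in> uq_ideal q \<Longrightarrow> - x \<in> uq_ideal q"
  "x \<in> uq_ideal q \<Longrightarrow> y * x \<in> uq_ideal q"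
  "x \<in> uq_ideal q \<Longrightarrow> x * y \<in> uq_ideal q"
proof -
  interpret ideal "uq_ideal q" free_alg_ring by (rule ideal_uq_ideal)
  show "0 \<in> uq_ideal q" "x \<in> uq_ideal q \<Longrightarrow> y \<in> uq_ideal q \<Longrightarrow> x + y \<in> uq_ideal q"
    "x \<in> uq_ideal q \<Longrightarrow> y * x \<in> uq_ideal q" "x \<in> uq_ideal q \<Longrightarrow> x * y \<in> uq_ideal q"
    using additive_subgroup.zero_closed[OF is_additive_subgroup]
      additive_subgroup.a_closed[OF is_additive_subgroup] I_l_closed I_r_closed by simp_all
  show "- x \<in> uq_ideal q" if "x \<in> uq_ideal q"
    using I_l_closed[OF that, of "-1"] by simp
qed

lemma uq_relators_subset: "uq_relators q \<subseteq> uq_ideal q"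
  unfolding uq_ideal_def by (rule ring.genideal_self[OF ring_free_alg_ring]) simp

lemma uq_ideal_minimal:
  assumes "uq_relators q \<subseteq> J" "0 \<in> J"
    "\<And>x y. x \<in> J \<Longrightarrow> y \<in> J \<Longrightarrow> x + y \<in> J"
    "\<And>x y. x \<in> J \<Longrightarrow> y * x \<in> J" "\<And>x y. x \<in> J \<Longrightarrow> x * y \<in> J"
  shows "uq_ideal q \<subseteq> J"
proof -
  interpret F: ring "free_alg_ring :: 'a free_alg ring" by (rule ring_free_alg_ring)
  have minus: "- x \<in> J" if "x \<in> J" for x using assms(4)[OF that, of "-1"] by simp
  have inv: "inv\<^bsub>add_monoid free_alg_ring\<^esub> x = - x" for x :: "'a free_alg"
    using F.minus_equality[of "- x" x] by (simp add: a_inv_def)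
  have "ideal J free_alg_ring"
  proof (rule idealI[OF ring_free_alg_ring])
    show "subgroup J (add_monoid free_alg_ring)"
      by (rule subgroup.intro, use assms minus in \<open>simp_all only: inv\<close>)
        (use assms in auto)
  qed (use assms in auto)
  then show ?thesis
    unfolding uq_ideal_def using ring.genideal_minimal[OF ring_free_alg_ring] assms(1) by blast
qed

subsection \<open>The antiautomorphism\<close>

lemma sigma_free_add: "sigma_free (x + y) = sigma_free x + sigma_free y"
  by (simp add: sigma_free_def pm_extend_add)

lemma sigma_free_minus: "sigma_free (x - y) = sigma_free x - sigma_free y"
  by (simp add: sigma_free_def pm_extend_minus)

lemma sigma_free_single [simp]:
  "sigma_free (Poly_Mapping.single w c) = Poly_Mapping.single (sigma_word w) c"
  by (simp add: sigma_free_def)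

lemma sigma_word_simps [simp]: "sigma_word 0 = 0" "sigma_word (Word [g]) = Word [sigma_gen g]"
  by (simp_all add: sigma_word_def zero_uq_word_def)

lemma sigma_free_one [simp]: "sigma_free 1 = 1"
  by (simp flip: single_one)

lemma sigma_free_mult: "sigma_free (x * y) = sigma_free y * sigma_free x"
proof (induction x rule: pm_induct)
  case (single v c)
  show ?case
  proof (induction y rule: pm_induct)
    case (single w d)
    show ?case
      by (simp add: mult_single sigma_word_def plus_uq_word_def mult.commute)
  qed (simp add: algebra_simps sigma_free_add)
qed (simp add: algebra_simps sigma_free_add)

lemma sigma_free_sigma_free [simp]: "sigma_free (sigma_free x) = x"
proof (induction x rule: pm_induct)
  case (single w c)
  have "sigma_gen (sigma_gen g) = g" for g by (cases g) auto
  then show ?case by (simp add: sigma_word_def rev_map o_def)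
qed (simp add: sigma_free_add)

lemma const_mult: "const c * y = pm_scale c y" "y * const c = pm_scale c y"
  by (induction y rule: pm_induct)
    (simp_all add: mult_single mult.commute algebra_simps pm_scale_add)

lemma pm_scale_mult:
  fixes x y :: "'k::field free_alg"
  shows "pm_scale c x * y = pm_scale c (x * y)" "x * pm_scale c y = pm_scale c (x * y)"
  by (metis const_mult mult.assoc)+

lemma sigma_free_uq_ideal:
  assumes "q \<noteq> 0"
  shows "sigma_free ` uq_ideal q = uq_ideal q"
proof -
  have "x \<in> sigma_free -` uq_ideal q" if x: "x \<in> uq_relators q" for x
  proof -
    let ?e = "gen Gen_e" and ?f = "gen Gen_f" and ?t = "gen Gen_t" and ?s = "gen Gen_tinv"
    have r1: "?t * ?s - 1 \<in> uq_ideal q" and r2: "?s * ?t - 1 \<in> uq_ideal q"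
      and r3: "?t * ?e * ?s - const (q\<^sup>2) * ?e \<in> uq_ideal q"
      and r4: "?t * ?f * ?s - const (inverse (q\<^sup>2)) * ?f \<in> uq_ideal q"
      and r5: "?e * ?f - ?f * ?e - const (1 / (q - inverse q)) * (?t - ?s) \<in> uq_ideal q"
      using uq_relators_subset[of q] by (auto simp: uq_relators_def)
    have conj: "?s * y * ?t - const (inverse c) * y \<in> uq_ideal q"
      if y: "?t * y * ?s - const c * y \<in> uq_ideal q" and "c \<noteq> 0" for c y
    proof -
      have "?s * y * ?t - const (inverse c) * y
          = const (inverse c) * ((?s * ?t - 1) * y * (?s * ?t) + y * (?s * ?t - 1)
              - ?s * (?t * y * ?s - const c * y) * ?t)"
        using \<open>c \<noteq> 0\<close>
        by (simp add: const_mult pm_scale_scale pm_scale_add pm_scale_diff pm_scale_mult algebra_simps)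
      also have "\<dots> \<in> uq_ideal q"
        using y r2 by (metis uq_ideal_closed diff_conv_add_uminus)
      finally show ?thesis .
    qed
    consider "x = ?t * ?s - 1" | "x = ?s * ?t - 1" | "x = ?t * ?e * ?s - const (q\<^sup>2) * ?e"
      | "x = ?t * ?f * ?s - const (inverse (q\<^sup>2)) * ?f"
      | "x = ?e * ?f - ?f * ?e - const (1 / (q - inverse q)) * (?t - ?s)"
      using x by (auto simp: uq_relators_def)
    then show ?thesis
    proof cases
      case 3
      show ?thesis
        using conj[OF r4] assms unfolding 3
        by (simp add: sigma_free_minus sigma_free_mult const_mult mult.assoc)
    next
      case 4
      show ?thesis
        using conj[OF r3] assms unfolding 4
        by (simp add: sigma_free_minus sigma_free_mult const_mult mult.assoc)
    next
      case 5
      show ?thesis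
        using r5 unfolding 5 by (simp add: sigma_free_minus sigma_free_mult) (simp add: const_mult)
    qed (use r1 r2 in \<open>simp_all add: sigma_free_minus sigma_free_mult\<close>)
  qed
  then have "uq_ideal q \<subseteq> sigma_free -` uq_ideal q"
    by (intro uq_ideal_minimal)
      (auto simp: sigma_free_add sigma_free_mult uq_ideal_closed sigma_free_def[of 0])
  then show ?thesis
    by (auto simp: image_iff) (metis sigma_free_sigma_free vimageE subsetD)
qed

lemma sigma_class:
  assumes "q \<noteq> 0"
  shows "sigma (uq_class q x) = uq_class q (sigma_free x)"
proof -
  have "sigma (uq_class q x) = {sigma_free y + sigma_free x | y. y \<in> uq_ideal q}"
    by (auto simp: sigma_def uq_class_altdef sigma_free_add image_def)
  also have "\<dots> = {z + sigma_free x | z. z \<in> sigma_free ` uq_ideal q}"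
    by blast
  finally show ?thesis
    by (simp only: sigma_free_uq_ideal[OF assms] uq_class_altdef)
qed

lemma sigma_antiautomorphism:
  assumes "q \<noteq> 0" "u \<in> carrier (Uq q)" "v \<in> carrier (Uq q)"
  shows "sigma u \<in> carrier (Uq q)" "sigma (sigma u) = u"
    "sigma (u \<oplus>\<^bsub>Uq q\<^esub> v) = sigma u \<oplus>\<^bsub>Uq q\<^esub> sigma v"
    "sigma (u \<otimes>\<^bsub>Uq q\<^esub> v) = sigma v \<otimes>\<^bsub>Uq q\<^esub> sigma u"
    "sigma (uq_class q (const c)) = uq_class q (const c)"
    "sigma (uq_class q (gen Gen_e)) = uq_class q (gen Gen_f)"
    "sigma (uq_class q (gen Gen_f)) = uq_class q (gen Gen_e)"
    "sigma (uq_class q (gen Gen_t)) = uq_class q (gen Gen_t)"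
  using assms
  by (auto simp: carrier_Uq sigma_class Uq_class_simps sigma_free_add sigma_free_mult)

subsection \<open>Verma modules\<close>

lemma verma_word_linear:
  "verma_word q l w (p + p') = verma_word q l w p + verma_word q l w p'"
  "verma_word q l w (pm_scale c p) = pm_scale c (verma_word q l w p)"
  "verma_word q l w 0 = 0"
proof -
  have "foldr (\<lambda>g. pm_extend (verma_gen q l g)) gs (p + p') =
      foldr (\<lambda>g. pm_extend (verma_gen q l g)) gs p + foldr (\<lambda>g. pm_extend (verma_gen q l g)) gs p'"
    "foldr (\<lambda>g. pm_extend (verma_gen q l g)) gs (pm_scale c p) =
      pm_scale c (foldr (\<lambda>g. pm_extend (verma_gen q l g)) gs p)" for gs c
    by (induction gs) (simp_all add: pm_extend_add pm_extend_scale)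
  then show "verma_word q l w (p + p') = verma_word q l w p + verma_word q l w p'"
    and sc: "verma_word q l w (pm_scale c p) = pm_scale c (verma_word q l w p)" for c
    by (simp_all add: verma_word_def)
  show "verma_word q l w 0 = 0"
    using sc[of 0] by simp
qed

lemma verma_free_linear:
  "verma_free q l x (p + p') = verma_free q l x p + verma_free q l x p'"
  "verma_free q l x (pm_scale c p) = pm_scale c (verma_free q l x p)"
  "verma_free q l (x + y) p = verma_free q l x p + verma_free q l y p"
  "verma_free q l (x - y) p = verma_free q l x p - verma_free q l y p"
  "verma_free q l (pm_scale c x) p = pm_scale c (verma_free q l x p)"
  "verma_free q l x 0 = 0" "verma_free q l 0 p = 0"
proof -
  show "verma_free q l x (p + p') = verma_free q l x p + verma_free q l x p'"
    by (simp add: verma_free_def pm_extend_def verma_word_linear pm_scale_add sum.distrib)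
  show "verma_free q l x (pm_scale c p) = pm_scale c (verma_free q l x p)"
    by (simp add: verma_free_def pm_extend_def verma_word_linear pm_scale_scale pm_scale_sum mult.commute)
  show "verma_free q l x 0 = 0"
    by (simp add: verma_free_def pm_extend_def verma_word_linear)
qed (simp_all add: verma_free_def pm_extend_add pm_extend_minus pm_extend_scale)

lemma verma_free_gen: "verma_free q l (gen g) p = pm_extend (verma_gen q l g) p"
  by (simp add: verma_free_def verma_word_def)

lemma verma_free_const: "verma_free q l (const c) p = pm_scale c p"
  by (simp add: verma_free_def verma_word_def zero_uq_word_def)

lemma verma_free_one: "verma_free q l 1 p = p"
  using verma_free_const[of q l 1 p] by simp

lemma verma_free_mult: "verma_free q l (x * y) p = verma_free q l x (verma_free q l y p)"
proof (induction x rule: pm_induct)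
  case (single v c)
  show ?case
  proof (induction y rule: pm_induct)
    case (single w d)
    have "verma_word q l (v + w) p = verma_word q l v (verma_word q l w p)"
      by (simp add: verma_word_def plus_uq_word_def)
    then show ?case
      by (simp add: mult_single verma_free_def verma_word_linear pm_scale_scale)
  qed (simp add: algebra_simps verma_free_linear)
qed (simp add: algebra_simps verma_free_linear)

lemma verma_free_uq_ideal:
  assumes "q \<noteq> 0" "q\<^sup>2 \<noteq> 1" "l \<noteq> 0" "x \<in> uq_ideal q"
  shows "verma_free q l x p = 0"
proof -
  have *: "(\<forall>p. verma_free q l x p = 0) \<longleftrightarrow> (\<forall>i. verma_free q l x (Poly_Mapping.single i 1) = 0)" for x
  proof (intro iffI allI)
    fix p assume *: "\<forall>i. verma_free q l x (Poly_Mapping.single i 1) = 0"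
    show "verma_free q l x p = 0"
    proof (induction p rule: pm_induct)
      case (single i c)
      show ?case
        using * verma_free_linear(2)[of q l x c "Poly_Mapping.single i 1"] by simp
    qed (simp add: verma_free_linear)
  qed blast
  have q: "q - inverse q \<noteq> 0"
    using assms by (auto simp: field_simps power2_eq_square)
  have "verma_free q l r (Poly_Mapping.single i 1) = 0" if r: "r \<in> uq_relators q" for r i
  proof -
    define a where "a = q powi int i"
    have a: "a \<noteq> 0"
      using assms by (simp add: a_def)
    have pw: "q powi (int i + 1) = a * q" "q powi (1 + int i) = a * q" "q powi (- int i - 1) = 1 / (a * q)"
      "q powi (1 - int i) = q / a" "q powi (int i - 1) = a / q"
      "q powi (- int i) = 1 / a" "q powi (- (2 * int i)) = 1 / a\<^sup>2"
      "q powi (- 2 - 2 * int i) = inverse (q\<^sup>2) / a\<^sup>2"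
      "q powi (2 - 2 * int i) = q\<^sup>2 / a\<^sup>2"
      using assms by (simp_all add: a_def power_int_diff power_int_add power_int_minus
          power_int_mult power_mult power_mult_distrib of_nat_diff field_simps power2_eq_square)
    consider "r = gen Gen_t * gen Gen_tinv - 1" | "r = gen Gen_tinv * gen Gen_t - 1"
      | "r = gen Gen_t * gen Gen_e * gen Gen_tinv - const (q\<^sup>2) * gen Gen_e"
      | "r = gen Gen_t * gen Gen_f * gen Gen_tinv - const (inverse (q\<^sup>2)) * gen Gen_f"
      | "r = gen Gen_e * gen Gen_f - gen Gen_f * gen Gen_e
           - const (1 / (q - inverse q)) * (gen Gen_t - gen Gen_tinv)"
      using r by (auto simp: uq_relators_def)
    then show ?thesis
    proof cases
      case 1
      then show ?thesis using a assms
        by (simp add: verma_free_linear verma_free_mult verma_free_gen verma_free_one pw)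
    next
      case 2
      then show ?thesis using a assms
        by (simp add: verma_free_linear verma_free_mult verma_free_gen verma_free_one pw)
    next
      case 3
      then show ?thesis using a assms
        by (simp add: verma_free_linear verma_free_mult verma_free_gen verma_free_const pw)
          (simp add: mult_ac)
    next
      case 4
      then show ?thesis using a assms
        by (simp add: verma_free_linear verma_free_mult verma_free_gen verma_free_const pw)
    next
      case 5
      let ?d = "q - inverse q" and ?m = "inverse l"
      have num: "(a * q - inverse (a * q)) * (l / a - a * ?m)
          - (a - inverse a) * (q * l / a - a * ?m / q) = ?d * (l / a\<^sup>2 - a\<^sup>2 * ?m)"
        using a assms by (simp add: field_simps power2_eq_square)
      have qi: "quantum_int q (1 + int i) = (a * q - inverse (a * q)) / ?d"
        "quantum_int q (int i) = (a - inverse a) / ?d"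
        using a assms power_int_minus[of q "1 + int i"]
        by (simp_all add: quantum_int_def pw divide_inverse a_def)
      have key: "quantum_int q (1 + int i) * ((l / a - a * ?m) / ?d)
          - quantum_int q (int i) * ((q * l / a - a * ?m / q) / ?d)
          = 1 / ?d * (l / a\<^sup>2 - a\<^sup>2 * ?m)"
        unfolding qi times_divide_times_eq diff_divide_distrib[symmetric] num using q by simp
      have "quantum_int q 0 = 0"
        by (simp add: quantum_int_def)
      then show ?thesis
        using key a q unfolding 5
        by (cases "i = 0"; auto simp: verma_free_linear verma_free_mult verma_free_gen verma_free_const pw a_def
            divide_inverse simp del: single_one simp flip: single_diff)
          (simp add: mult_ac)
    qed
  qed
  then have "verma_free q l r p = 0" if "r \<in> uq_relators q" for r p
    using that * by blast
  then have "uq_ideal q \<subseteq> {x. \<forall>p. verma_free q l x p = 0}"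
    by (intro uq_ideal_minimal) (auto simp: verma_free_linear verma_free_mult)
  then show ?thesis
    using assms by blast
qed

lemma verma_smult_class:
  assumes "q \<noteq> 0" "q\<^sup>2 \<noteq> 1" "l \<noteq> 0"
  shows "uq_class q x \<odot>\<^bsub>verma q l\<^esub> p = verma_free q l x p"
proof -
  have "(\<lambda>y. verma_free q l y p) ` uq_class q x = {verma_free q l x p}"
    using verma_free_uq_ideal[OF assms] uq_ideal_closed(1)[of q]
    by (force simp: uq_class_altdef verma_free_linear image_def)
  then show ?thesis
    by (simp add: verma_def)
qed

lemma left_module_verma:
  assumes "q \<noteq> 0" "q\<^sup>2 \<noteq> 1" "l \<noteq> 0"
  shows "left_module (Uq q) (verma q l)"
proof -
  have "\<exists>y. x + y = 0" for x :: "nat \<Rightarrow>\<^sub>0 'a"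
    using add.right_inverse by blast
  then have "abelian_group (verma q l)"
    by (intro abelian_groupI) (auto simp: verma_def algebra_simps add.commute)
  then show ?thesis
    unfolding left_module_def left_module_axioms_def
    using ring_Uq[of q] 
    by (auto simp: carrier_Uq verma_smult_class[OF assms] Uq_class_simps verma_free_linear
      verma_free_mult verma_free_one)
      (auto simp: verma_def verma_free_linear)
qed

end

theory Submission
  imports Defs
begin

text \<open>A module with finite-dimensional weight spaces is isomorphic to its restricted dual as soon as
  it carries a nondegenerate symmetric bilinear form \<open>B\<close> with \<open>B (u x, y) = B (x, \<sigma>(u) y)\<close>. On
  \<open>M(\<lambda>)\<close> the basis vectors are orthogonal with \<open>B (v\<^sub>i, v\<^sub>i) = a\<^sub>1 \<cdots> a\<^sub>i\<close>, where \<open>e v\<^sub>i = a\<^sub>i v\<^sub>i\<^sub>-\<^sub>1\<close>,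
  and the \<open>a\<^sub>i\<close> do not vanish unless \<open>\<lambda> = \<plusminus>q\<^sup>n\<close>.

  For \<open>T(n,\<epsilon>)\<close> put \<open>\<nu> = C - \<epsilon> c\<close>, so that \<open>\<nu>\<^sup>2 = 0\<close>. The weight spaces of weight \<open>\<epsilon> q\<^bsup>n-2i\<^esup>\<close> are
  free of rank 1 over \<open>k[\<nu>]/(\<nu>\<^sup>2)\<close> for \<open>i > n\<close> and are annihilated by \<open>\<nu>\<close> for \<open>i \<le> n\<close>. On the former,
  \<open>B\<close> is \<open>(x, y) \<mapsto> tr (g\<^sub>i x y)\<close> with \<open>g\<^sub>i\<close> a unit of \<open>k[\<nu>]/(\<nu>\<^sup>2)\<close> and \<open>tr\<close> the coefficient of
  \<open>\<nu>\<close>. That the expected basis spans \<open>T(n,\<epsilon>)\<close> follows from the relations; that it is linearly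
  independent follows by letting the free algebra act on an explicit model.\<close>

section \<open>Linear functionals on free vector spaces\<close>

text \<open>A functional is stored as the family \<open>F\<close> of its values on the basis. Only
  \<open>p\<close> has finite support, so arbitrary linear functionals are covered.\<close>

definition pm_dot :: "('a \<Rightarrow>\<^sub>0 'k::field) \<Rightarrow> ('a \<Rightarrow> 'k) \<Rightarrow> 'k" where
  "pm_dot p F = (\<Sum>i\<in>Poly_Mapping.keys p. Poly_Mapping.lookup p i * F i)"

lemma pm_dot_superset:
  assumes "finite A" "Poly_Mapping.keys p \<subseteq> A"
  shows "pm_dot p F = (\<Sum>i\<in>A. Poly_Mapping.lookup p i * F i)"
  unfolding pm_dot_def using assms
  by (intro sum.mono_neutral_left) (auto simp: in_keys_iff)

lemma pm_dot_add: "pm_dot (p + p') F = pm_dot p F + pm_dot p' F"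
proof -
  let ?A = "Poly_Mapping.keys p \<union> Poly_Mapping.keys p'"
  show ?thesis
    using pm_dot_superset[of ?A "p + p'" F] pm_dot_superset[of ?A p F]
      pm_dot_superset[of ?A p' F] Poly_Mapping.keys_add[of p p']
    by (simp add: lookup_add algebra_simps sum.distrib)
qed

lemma pm_dot_single [simp]: "pm_dot (Poly_Mapping.single i c) F = c * F i"
  by (subst pm_dot_superset[of "{i}"]) auto

lemma pm_dot_0 [simp]: "pm_dot 0 F = 0"
  by (simp add: pm_dot_def)

lemma pm_dot_scale: "pm_dot (pm_scale c p) F = c * pm_dot p F"
proof -
  have "Poly_Mapping.keys (pm_scale c p) \<subseteq> Poly_Mapping.keys p"
    by (auto simp: in_keys_iff)
  then show ?thesis
    using pm_dot_superset[of "Poly_Mapping.keys p" "pm_scale c p" F]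
    by (simp add: pm_dot_def sum_distrib_left mult.assoc)
qed

lemma pm_dot_sum: "pm_dot (sum f A) F = (\<Sum>i\<in>A. pm_dot (f i) F)"
  by (induction A rule: infinite_finite_induct) (simp_all add: pm_dot_add)

lemma pm_dot_fun_scale: "pm_dot p (\<lambda>i. c * F i) = c * pm_dot p F"
  by (simp add: pm_dot_def sum_distrib_left mult_ac)

lemma pm_dot_swap:
  "pm_dot p (\<lambda>i. pm_dot r (\<lambda>j. b i j)) = pm_dot r (\<lambda>j. pm_dot p (\<lambda>i. b i j))"
  unfolding pm_dot_def sum_distrib_left
  by (subst sum.swap) (simp add: mult_ac)

lemma pm_dot_delta: "pm_dot p (\<lambda>i. if j = i then 1 else 0) = Poly_Mapping.lookup p j"
  by (simp add: pm_dot_def in_keys_iff if_distrib cong: if_cong)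

lemma pm_dot_extend: "pm_dot (pm_extend u p) F = pm_dot p (\<lambda>i. pm_dot (u i) F)"
  by (simp add: pm_extend_def pm_dot_sum pm_dot_scale) (simp add: pm_dot_def)

lemma lookup_pm_extend_diagonal:
  "Poly_Mapping.lookup (pm_extend (\<lambda>i. Poly_Mapping.single i (c i)) p) j
    = c j * Poly_Mapping.lookup p j"
  by (auto simp: pm_extend_def lookup_sum lookup_single in_keys_iff when_def sum.delta' mult.commute)

section \<open>Left modules\<close>

text \<open>Transports the module axioms along a surjection that respects the operations; it serves
  both for quotients and for restricted duals. Since \<open>N\<close> is at first only a record of
  operations, \<open>h_zero\<close> cannot be deduced from additivity.\<close>

lemma left_module_image:
  fixes M :: "('a, 'b) module" and N :: "('a, 'c) module"
  assumes M: "left_module R M" and onto: "h ` carrier M = carrier N"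
    and h_add: "\<And>x y. x \<in> carrier M \<Longrightarrow> y \<in> carrier M \<Longrightarrow> h (x \<oplus>\<^bsub>M\<^esub> y) = h x \<oplus>\<^bsub>N\<^esub> h y"
    and h_smult: "\<And>a x. a \<in> carrier R \<Longrightarrow> x \<in> carrier M \<Longrightarrow> h (a \<odot>\<^bsub>M\<^esub> x) = a \<odot>\<^bsub>N\<^esub> h x"
    and h_zero: "h \<zero>\<^bsub>M\<^esub> = \<zero>\<^bsub>N\<^esub>"
  shows "left_module R N"
proof -
  interpret left_module R M by (rule M)
  \<comment> \<open>Quantifiers over \<open>carrier N\<close> become quantifiers over
    \<open>carrier M\<close>; pulling the operations inside \<open>h\<close> then reduces each axiom
    to the same axiom of \<open>M\<close>.\<close>
  have ball: "(\<forall>x\<in>carrier N. P x) \<longleftrightarrow> (\<forall>x\<in>carrier M. P (h x))" for P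
    unfolding onto[symmetric] by blast
  have closed: "h x \<in> carrier N" if "x \<in> carrier M" for x
    using onto that by blast
  have "abelian_group N"
  proof (rule abelian_groupI)
    have "\<forall>x\<in>carrier N. \<forall>y\<in>carrier N. x \<oplus>\<^bsub>N\<^esub> y \<in> carrier N"
      unfolding ball by (simp add: closed flip: h_add)
    then show "x \<oplus>\<^bsub>N\<^esub> y \<in> carrier N" if "x \<in> carrier N" "y \<in> carrier N" for x y
      using that by blast
    show "\<zero>\<^bsub>N\<^esub> \<in> carrier N"
      using closed[of "\<zero>\<^bsub>M\<^esub>"] h_zero by simp
    have "\<forall>x\<in>carrier N. \<forall>y\<in>carrier N. \<forall>z\<in>carrier N. x \<oplus>\<^bsub>N\<^esub> y \<oplus>\<^bsub>N\<^esub> z = x \<oplus>\<^bsub>N\<^esub> (y \<oplus>\<^bsub>N\<^esub> z)"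
      unfolding ball by (simp add: M.a_assoc flip: h_add)
    then show "x \<oplus>\<^bsub>N\<^esub> y \<oplus>\<^bsub>N\<^esub> z = x \<oplus>\<^bsub>N\<^esub> (y \<oplus>\<^bsub>N\<^esub> z)"
      if "x \<in> carrier N" "y \<in> carrier N" "z \<in> carrier N" for x y z
      using that by blast
    have "\<forall>x\<in>carrier N. \<forall>y\<in>carrier N. x \<oplus>\<^bsub>N\<^esub> y = y \<oplus>\<^bsub>N\<^esub> x"
      unfolding ball by (simp add: M.a_comm flip: h_add)
    then show "x \<oplus>\<^bsub>N\<^esub> y = y \<oplus>\<^bsub>N\<^esub> x" if "x \<in> carrier N" "y \<in> carrier N" for x y
      using that by blast
    have "\<forall>x\<in>carrier N. \<zero>\<^bsub>N\<^esub> \<oplus>\<^bsub>N\<^esub> x = x"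
      unfolding ball h_zero[symmetric] by (simp flip: h_add)
    then show "\<zero>\<^bsub>N\<^esub> \<oplus>\<^bsub>N\<^esub> x = x" if "x \<in> carrier N" for x
      using that by blast
    have "\<forall>x\<in>carrier N. \<exists>y\<in>carrier N. y \<oplus>\<^bsub>N\<^esub> x = \<zero>\<^bsub>N\<^esub>"
      unfolding ball
    proof
      fix x assume x: "x \<in> carrier M"
      then have "h (\<ominus>\<^bsub>M\<^esub> x) \<oplus>\<^bsub>N\<^esub> h x = \<zero>\<^bsub>N\<^esub>"
        using h_zero by (simp add: M.l_neg flip: h_add)
      then show "\<exists>y\<in>carrier N. y \<oplus>\<^bsub>N\<^esub> h x = \<zero>\<^bsub>N\<^esub>"
        using closed x by blast
    qed
    then show "\<exists>y\<in>carrier N. y \<oplus>\<^bsub>N\<^esub> x = \<zero>\<^bsub>N\<^esub>" if "x \<in> carrier N" for x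
      using that by blast
  qed
  moreover have "left_module_axioms R N"
  proof
    fix a b x y assume a: "a \<in> carrier R" and x: "x \<in> carrier N"
    obtain x' where x': "x' \<in> carrier M" "x = h x'"
      using x onto by blast
    show "a \<odot>\<^bsub>N\<^esub> x \<in> carrier N"
      using a x' by (simp add: smult_closed closed flip: h_smult)
    show "(a \<oplus>\<^bsub>R\<^esub> b) \<odot>\<^bsub>N\<^esub> x = a \<odot>\<^bsub>N\<^esub> x \<oplus>\<^bsub>N\<^esub> b \<odot>\<^bsub>N\<^esub> x"
      "(a \<otimes>\<^bsub>R\<^esub> b) \<odot>\<^bsub>N\<^esub> x = a \<odot>\<^bsub>N\<^esub> (b \<odot>\<^bsub>N\<^esub> x)" if "b \<in> carrier R"
      using a that x' by (simp_all add: smult_closed smult_l_distr smult_assoc flip: h_smult h_add)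
    show "a \<odot>\<^bsub>N\<^esub> (x \<oplus>\<^bsub>N\<^esub> y) = a \<odot>\<^bsub>N\<^esub> x \<oplus>\<^bsub>N\<^esub> a \<odot>\<^bsub>N\<^esub> y" if "y \<in> carrier N"
    proof -
      obtain y' where "y' \<in> carrier M" "y = h y'"
        using \<open>y \<in> carrier N\<close> onto by blast
      then show ?thesis
        using a x' by (simp add: smult_closed smult_r_distr flip: h_smult h_add)
    qed
  next
    have "\<forall>x\<in>carrier N. \<one>\<^bsub>R\<^esub> \<odot>\<^bsub>N\<^esub> x = x"
      unfolding ball by (simp add: smult_one flip: h_smult)
    then show "\<one>\<^bsub>R\<^esub> \<odot>\<^bsub>N\<^esub> x = x" if "x \<in> carrier N" for x
      using that by blast
  qed
  ultimately show ?thesis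
    using M by (simp add: left_module_def)
qed

text \<open>Every monomial is a constant times a product of generators, so properties stable under
  sums and products need checking only on constants and generators.\<close>

lemma free_alg_induct [case_names const gen add mult]:
  assumes "\<And>c. P (const c)" "\<And>g. P (gen g)"
    "\<And>x y. P x \<Longrightarrow> P y \<Longrightarrow> P (x + y)" "\<And>x y. P x \<Longrightarrow> P y \<Longrightarrow> P (x * y)"
  shows "P (x :: 'k::field free_alg)"
proof (induction x rule: pm_induct)
  case (single w c)
  have "P (Poly_Mapping.single (Word gs) 1)" for gs
  proof (induction gs)
    case Nil
    then show ?case using assms(1)[of 1] by (simp add: zero_uq_word_def)
  next
    case (Cons g gs)
    have "Poly_Mapping.single (Word (g # gs)) (1::'k) = gen g * Poly_Mapping.single (Word gs) 1"
      by (simp add: mult_single plus_uq_word_def)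
    then show ?case using assms(2,4) Cons by simp
  qed
  then have "P (const c * Poly_Mapping.single w 1)"
    by (cases w) (simp add: assms)
  then show ?case
    by (simp add: mult_single)
qed (rule assms)

section \<open>Contravariant forms and self-duality\<close>

text \<open>The isomorphism from \<open>M\<close> to its dual is \<open>m \<mapsto> B (m, _)\<close>. The restricted dual is
  only seen to be a module as the image of \<open>M\<close> under this map.\<close>

lemma self_dual_if_contravariant_form:
  fixes q :: "'k::field" and M :: "('k free_alg set, 'm) module"
    and \<pi> :: "'m \<Rightarrow> ('i \<Rightarrow>\<^sub>0 'k)" and \<rho> :: "uq_gen \<Rightarrow> 'i \<Rightarrow> ('i \<Rightarrow>\<^sub>0 'k)" and b :: "'i \<Rightarrow> 'i \<Rightarrow> 'k"
  assumes q: "q \<noteq> 0" and M: "left_module (Uq q) M"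
    and bij: "bij_betw \<pi> (carrier M) UNIV"
    and \<pi>_add: "\<And>x y. x \<in> carrier M \<Longrightarrow> y \<in> carrier M \<Longrightarrow> \<pi> (x \<oplus>\<^bsub>M\<^esub> y) = \<pi> x + \<pi> y"
    and \<pi>_const: "\<And>c x. x \<in> carrier M \<Longrightarrow> \<pi> (uq_class q (const c) \<odot>\<^bsub>M\<^esub> x) = pm_scale c (\<pi> x)"
    and \<pi>_gen: "\<And>g x. x \<in> carrier M \<Longrightarrow> \<pi> (uq_class q (gen g) \<odot>\<^bsub>M\<^esub> x) = pm_extend (\<rho> g) (\<pi> x)"
    and \<rho>_t: "\<And>i. \<rho> Gen_t i = Poly_Mapping.single i (wt i)"
      "\<And>i. \<rho> Gen_tinv i = Poly_Mapping.single i (inverse (wt i))"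
    and wt: "\<And>i. wt i \<noteq> 0" "\<And>\<omega>. finite {i. wt i = \<omega>}"
    and b_sym: "\<And>i j. b i j = b j i"
    and b_wt: "\<And>i j. b i j \<noteq> 0 \<Longrightarrow> wt i = wt j"
    and b_ef: "\<And>i j. pm_dot (\<rho> Gen_e i) (b j) = pm_dot (\<rho> Gen_f j) (b i)"
    and \<gamma>: "\<And>i j. pm_dot (\<gamma> i) (b j) = (if i = j then 1 else 0)"
  shows "isomorphic_left_modules (Uq q) (sigma_dual q M) M"
proof -
  interpret left_module "Uq q" M by (rule M)
  \<comment> \<open>\<open>B\<close> is the bilinear extension of the Gram matrix \<open>b\<close>.
    Its nondegeneracy is given in the form of the dual basis \<open>\<gamma>\<close>, with which
    \<open>B\<close> reads off coordinates, see \<open>B_\<gamma>\<close>.\<close>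
  define B where "B p r = pm_dot p (\<lambda>i. pm_dot r (b i))" for p r
  define h where "h m = restrict (\<lambda>m'. B (\<pi> m) (\<pi> m')) (carrier M)" for m
  define v where "v p = inv_into (carrier M) \<pi> p" for p
  have v: "v p \<in> carrier M" "\<pi> (v p) = p" for p
    using bij unfolding v_def bij_betw_def by (auto intro: inv_into_into f_inv_into_f)
  have inj: "x = y" if "x \<in> carrier M" "y \<in> carrier M" "\<pi> x = \<pi> y" for x y
    using bij that by (auto simp: bij_betw_def inj_on_def)
  have cls: "uq_class q x \<in> carrier (Uq q)" for x
    by (simp add: carrier_Uq)
  have \<pi>_0: "\<pi> \<zero>\<^bsub>M\<^esub> = 0"
    using \<pi>_add[of "\<zero>\<^bsub>M\<^esub>" "\<zero>\<^bsub>M\<^esub>"] by simp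
  have B_sym: "B p r = B r p" for p r
    unfolding B_def by (subst pm_dot_swap) (simp add: b_sym)
  have B_add: "B (p + p') r = B p r + B p' r" "B r (p + p') = B r p + B r p'" for p p' r
  proof -
    show "B (p + p') r = B p r + B p' r" for p p' r
      by (simp add: B_def pm_dot_add)
    then show "B r (p + p') = B r p + B r p'"
      by (metis B_sym)
  qed
  have B_scale: "B (pm_scale c p) r = c * B p r" "B r (pm_scale c p) = c * B r p" for p c r
  proof -
    show "B (pm_scale c p) r = c * B p r" for p c r
      by (simp add: B_def pm_dot_scale)
    then show "B r (pm_scale c p) = c * B r p"
      by (metis B_sym)
  qed
  have B_ef: "B (pm_extend (\<rho> Gen_e) p) r = B p (pm_extend (\<rho> Gen_f) r)" for p r
  proof -
    have "B (pm_extend (\<rho> Gen_e) p) r = pm_dot p (\<lambda>i. pm_dot (\<rho> Gen_e i) (\<lambda>k. pm_dot r (b k)))"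
      by (simp add: B_def pm_dot_extend)
    also have "\<dots> = pm_dot p (\<lambda>i. pm_dot r (\<lambda>j. pm_dot (\<rho> Gen_e i) (b j)))"
      by (subst pm_dot_swap) (subst b_sym, rule refl)
    also have "\<dots> = B p (pm_extend (\<rho> Gen_f) r)"
      by (simp add: B_def pm_dot_extend b_ef)
    finally show ?thesis .
  qed
  \<comment> \<open>Only basis vectors of equal weight pair nontrivially, so every operator acting
    by a function of the weight is self-adjoint. This handles t and its inverse, which
    \<open>sigma_gen\<close> fixes.\<close>
  have B_diag: "B (pm_extend (\<lambda>i. Poly_Mapping.single i (u (wt i))) p) r
      = B p (pm_extend (\<lambda>i. Poly_Mapping.single i (u (wt i))) r)" for u p r
  proof -
    have "u (wt i) * b i j = u (wt j) * b i j" for i j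
      using b_wt[of i j] by (cases "b i j = 0") auto
    then have "(\<lambda>j. u (wt i) * b i j) = (\<lambda>j. u (wt j) * b i j)" for i
      by (rule ext)
    then show ?thesis
      by (simp add: B_def pm_dot_extend flip: pm_dot_fun_scale)
  qed
  have \<rho>_t': "\<rho> Gen_t = (\<lambda>i. Poly_Mapping.single i (wt i))"
    "\<rho> Gen_tinv = (\<lambda>i. Poly_Mapping.single i (inverse (wt i)))"
    by (simp_all add: \<rho>_t fun_eq_iff)
  have B_gen: "B (pm_extend (\<rho> g) p) r = B p (pm_extend (\<rho> (sigma_gen g)) r)" for g p r
  proof (cases g)
    case Gen_f
    then show ?thesis using B_ef[of r p] B_sym by simp
  next
    case Gen_t
    then show ?thesis using B_diag[of "\<lambda>x. x"] by (simp add: \<rho>_t')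
  next
    case Gen_tinv
    then show ?thesis using B_diag[of inverse] by (simp add: \<rho>_t')
  qed (simp add: B_ef)
  \<comment> \<open>Adjoints reverse products, and so does \<open>sigma_free\<close>; hence
    contravariance passes from the generators to all of the free algebra.\<close>
  have B_class: "\<forall>m\<in>carrier M. \<forall>m'\<in>carrier M. B (\<pi> (uq_class q x \<odot>\<^bsub>M\<^esub> m)) (\<pi> m')
      = B (\<pi> m) (\<pi> (uq_class q (sigma_free x) \<odot>\<^bsub>M\<^esub> m'))" for x
  proof (induction x rule: free_alg_induct)
    case (const c)
    then show ?case by (simp add: \<pi>_const B_scale)
  next
    case (gen g)
    then show ?case by (simp add: \<pi>_gen B_gen)
  next
    case (add x y)
    then show ?case
      by (simp add: sigma_free_add smult_l_distr \<pi>_add B_add cls smult_closed flip: Uq_class_simps)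
  next
    case (mult x y)
    then show ?case
      by (simp add: sigma_free_mult smult_assoc cls smult_closed flip: Uq_class_simps)
  qed
  have B_\<gamma>: "B (\<gamma> j) p = Poly_Mapping.lookup p j" for j p
    unfolding B_def by (subst pm_dot_swap) (subst b_sym, simp add: \<gamma> pm_dot_delta)

  \<comment> \<open>In coordinates t is diagonal, so a weight vector is a vector supported on basis
    vectors of that weight.\<close>
  have ws: "m \<in> weight_space q M \<omega> \<longleftrightarrow>
      m \<in> carrier M \<and> (\<forall>i\<in>Poly_Mapping.keys (\<pi> m). wt i = \<omega>)" for m \<omega>
  proof -
    have "m \<in> weight_space q M \<omega> \<longleftrightarrow> m \<in> carrier M \<and> pm_extend (\<rho> Gen_t) (\<pi> m) = pm_scale \<omega> (\<pi> m)"
      using inj[of "uq_class q (gen Gen_t) \<odot>\<^bsub>M\<^esub> m" "uq_class q (const \<omega>) \<odot>\<^bsub>M\<^esub> m"]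
      by (auto simp: weight_space_def smult_closed cls \<pi>_const \<pi>_gen)
        (metis \<pi>_const \<pi>_gen)
    then show ?thesis
      by (auto simp: poly_mapping_eq_iff fun_eq_iff \<rho>_t' lookup_pm_extend_diagonal in_keys_iff)
  qed
  have h_dual: "h m \<in> restricted_dual q M" if m: "m \<in> carrier M" for m
  proof -
    \<comment> \<open>A weight that does not occur in the support of \<open>\<pi> m\<close> is
      orthogonal to \<open>m\<close>, which leaves finitely many weights.\<close>
    have "{\<omega> \<in> weights q M. \<not> (\<forall>m'\<in>weight_space q M \<omega>. h m m' = 0)} \<subseteq> wt ` Poly_Mapping.keys (\<pi> m)"
    proof (rule subsetI, rule ccontr)
      fix \<omega> assume \<omega>: "\<omega> \<in> {\<omega> \<in> weights q M. \<not> (\<forall>m'\<in>weight_space q M \<omega>. h m m' = 0)}"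
        and notin: "\<omega> \<notin> wt ` Poly_Mapping.keys (\<pi> m)"
      have "h m m' = 0" if m': "m' \<in> weight_space q M \<omega>" for m'
      proof -
        have "b i j = 0" if "i \<in> Poly_Mapping.keys (\<pi> m)" "j \<in> Poly_Mapping.keys (\<pi> m')" for i j
          using that notin m' b_wt[of i j] by (auto simp: ws)
        then show ?thesis
          using m' by (auto simp: h_def B_def pm_dot_def ws intro!: sum.neutral)
      qed
      then show False
        using \<omega> by auto
    qed
    then have "finite {\<omega> \<in> weights q M. \<not> (\<forall>m'\<in>weight_space q M \<omega>. h m m' = 0)}"
      by (rule finite_subset) simp
    then show ?thesis
      using m by (auto simp: restricted_dual_def linear_functionals_def h_def \<pi>_add \<pi>_const
          B_add B_scale smult_closed cls)
  qed
  have h_onto: "\<phi> \<in> h ` carrier M" if \<phi>: "\<phi> \<in> restricted_dual q M" for \<phi>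
  proof -
    define F where "F i = \<phi> (v (Poly_Mapping.single i 1))" for i
    let ?W = "{\<omega> \<in> weights q M. \<not> (\<forall>m\<in>weight_space q M \<omega>. \<phi> m = 0)}"
    have lin: "x \<in> carrier M \<Longrightarrow> y \<in> carrier M \<Longrightarrow> \<phi> (x \<oplus>\<^bsub>M\<^esub> y) = \<phi> x + \<phi> y"
      "x \<in> carrier M \<Longrightarrow> \<phi> (uq_class q (const c) \<odot>\<^bsub>M\<^esub> x) = c * \<phi> x" for x y c
      using \<phi> by (auto simp: restricted_dual_def linear_functionals_def)
    have v_add: "v (p + r) = v p \<oplus>\<^bsub>M\<^esub> v r" for p r
      by (rule inj) (simp_all add: v \<pi>_add)
    have v_single: "v (Poly_Mapping.single i c) = uq_class q (const c) \<odot>\<^bsub>M\<^esub> v (Poly_Mapping.single i 1)" for i c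
      by (rule inj) (simp_all add: v \<pi>_const smult_closed cls)
    have \<phi>_v: "\<phi> (v p) = pm_dot p F" for p
    proof (induction p rule: pm_induct)
      case (single i c)
      then show ?case by (subst v_single) (simp add: lin v F_def)
    qed (simp add: v_add lin v pm_dot_add)
    \<comment> \<open>The restricted dual allows finitely many weights, and each weight belongs to
      finitely many basis vectors. Hence \<open>\<phi>\<close> has finitely many nonzero
      coordinates, and the expansion \<open>p\<close> in the dual basis below is a finite
      sum.\<close>
    have "{i. F i \<noteq> 0} \<subseteq> (\<Union>\<omega>\<in>?W. {i. wt i = \<omega>})"
    proof
      fix i assume "i \<in> {i. F i \<noteq> 0}"
      then have i: "\<phi> (v (Poly_Mapping.single i 1)) \<noteq> 0"
        by (simp add: F_def)
      have "v (Poly_Mapping.single i 1) \<in> weight_space q M (wt i)"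
        by (simp add: ws v)
      moreover have "v (Poly_Mapping.single i 1) \<noteq> \<zero>\<^bsub>M\<^esub>"
        using v(2)[of "Poly_Mapping.single i 1"] \<pi>_0 by (metis lookup_single_eq lookup_zero zero_neq_one)
      ultimately have "wt i \<in> ?W"
        using wt(1) i by (auto simp: weights_def)
      then show "i \<in> (\<Union>\<omega>\<in>?W. {i. wt i = \<omega>})"
        by blast
    qed
    moreover have "finite (\<Union>\<omega>\<in>?W. {i. wt i = \<omega>})"
      using \<phi> wt(2) by (simp add: restricted_dual_def)
    ultimately have fin: "finite {i. F i \<noteq> 0}"
      by (rule finite_subset)
    define p where "p = (\<Sum>i | F i \<noteq> 0. pm_scale (F i) (\<gamma> i))"
    have "B p r = pm_dot r F" for r
    proof -
      have "B p r = (\<Sum>i | F i \<noteq> 0. F i * B (\<gamma> i) r)"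
        by (simp add: p_def B_def pm_dot_sum pm_dot_scale)
      also have "\<dots> = (\<Sum>i | F i \<noteq> 0. F i * Poly_Mapping.lookup r i)"
        by (simp add: B_\<gamma>)
      also have "\<dots> = (\<Sum>i \<in> {i. F i \<noteq> 0} \<union> Poly_Mapping.keys r. Poly_Mapping.lookup r i * F i)"
        using fin by (intro sum.mono_neutral_cong_left) (auto simp: mult.commute)
      also have "\<dots> = pm_dot r F"
        using fin by (intro pm_dot_superset[symmetric]) auto
      finally show ?thesis .
    qed
    then have "h (v p) m = \<phi> m" if "m \<in> carrier M" for m
      using \<phi>_v[of "\<pi> m"] that inj[of "v (\<pi> m)" m] v by (simp add: h_def)
    moreover have "\<phi> \<in> extensional (carrier M)"
      using \<phi> by (simp add: restricted_dual_def linear_functionals_def)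
    ultimately have "h (v p) = \<phi>"
      by (intro extensionalityI[of _ "carrier M"]) (auto simp: h_def)
    then show ?thesis
      using v(1) by blast
  qed
  have h_inj: "inj_on h (carrier M)"
  proof (rule inj_onI)
    fix x y assume x: "x \<in> carrier M" and y: "y \<in> carrier M" and "h x = h y"
    then have "B (\<pi> x) (\<pi> m) = B (\<pi> y) (\<pi> m)" if "m \<in> carrier M" for m
      using that by (auto simp: h_def dest!: fun_cong[of _ _ m])
    then have "B (\<pi> x) (\<gamma> j) = B (\<pi> y) (\<gamma> j)" for j
      using v[of "\<gamma> j"] by metis
    then have "\<pi> x = \<pi> y"
      by (intro poly_mapping_eqI) (metis B_\<gamma> B_sym)
    with x y show "x = y" by (rule inj)
  qed
  have onto: "h ` carrier M = carrier (sigma_dual q M)"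
    using h_dual h_onto by (auto simp: sigma_dual_def)
  have h_add: "h (x \<oplus>\<^bsub>M\<^esub> y) = h x \<oplus>\<^bsub>sigma_dual q M\<^esub> h y" if "x \<in> carrier M" "y \<in> carrier M" for x y
    using that by (auto simp: sigma_dual_def h_def \<pi>_add B_add fun_eq_iff)
  have h_smult: "h (a \<odot>\<^bsub>M\<^esub> x) = a \<odot>\<^bsub>sigma_dual q M\<^esub> h x"
    if "a \<in> carrier (Uq q)" "x \<in> carrier M" for a x
    using that B_class q by (auto simp: sigma_dual_def h_def fun_eq_iff carrier_Uq sigma_class smult_closed)
  have h_0: "h \<zero>\<^bsub>M\<^esub> = \<zero>\<^bsub>sigma_dual q M\<^esub>"
    by (simp add: h_def sigma_dual_def \<pi>_0 B_def)
  have dual: "left_module (Uq q) (sigma_dual q M)"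
    by (rule left_module_image[OF M onto h_add h_smult h_0])
  \<comment> \<open>The isomorphism is required in the direction from the dual to \<open>M\<close>,
    hence the inverse of \<open>h\<close>.\<close>
  have "the_inv_into (carrier M) h \<in> left_module_iso (Uq q) (sigma_dual q M) M"
  proof -
    let ?k = "the_inv_into (carrier M) h"
    have k: "?k (h x) = x" if "x \<in> carrier M" for x
      using that by (rule the_inv_into_f_f[OF h_inj])
    have "bij_betw ?k (carrier (sigma_dual q M)) (carrier M)"
      using h_inj onto by (intro bij_betw_the_inv_into) (simp add: bij_betw_def)
    then show ?thesis
      unfolding left_module_iso_def onto[symmetric]
      by (simp add: k smult_closed flip: h_add h_smult)
  qed
  then show ?thesis
    using dual M by (auto simp: isomorphic_left_modules_def)
qed

section \<open>Verma modules\<close>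

text \<open>The Casimir element acts on a highest weight vector of weight \<open>\<omega>\<close> by \<open>casimir_value q \<omega>\<close>, so
  \<open>f e\<close> acts on the vector of weight \<open>\<omega>\<close> of \<open>M(\<lambda>)\<close> by
  \<open>casimir_value q \<lambda> - casimir_value q \<omega>\<close>.\<close>

definition casimir_value :: "'k::field \<Rightarrow> 'k \<Rightarrow> 'k" where
  "casimir_value q \<omega> = (q * \<omega> + inverse (q * \<omega>)) / (q - inverse q)\<^sup>2"

text \<open>The weight \<open>q powi (- 2 * int i) * l\<close>, rewritten with a natural exponent so
  that passing to \<open>Suc i\<close> is division by \<open>q\<^sup>2\<close>.\<close>

definition verma_weight :: "'k::field \<Rightarrow> 'k \<Rightarrow> nat \<Rightarrow> 'k" where
  "verma_weight q l i = l / (q\<^sup>2) ^ i"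

definition fe_coeff :: "'k::field \<Rightarrow> 'k \<Rightarrow> nat \<Rightarrow> 'k" where
  "fe_coeff q l i = casimir_value q l - casimir_value q (verma_weight q l i)"

lemma fe_coeff_0 [simp]: "fe_coeff q l 0 = 0"
  by (simp add: fe_coeff_def verma_weight_def)

lemma verma_weight_Suc: "verma_weight q l (Suc i) = verma_weight q l i / q\<^sup>2"
  by (simp add: verma_weight_def)

lemma verma_weight_nonzero: "q \<noteq> 0 \<Longrightarrow> l \<noteq> 0 \<Longrightarrow> verma_weight q l i \<noteq> 0"
  by (simp add: verma_weight_def)

context
  fixes q :: "'k::field"
  assumes q: "q \<noteq> 0" and q_not_root: "\<And>m::nat. m > 0 \<Longrightarrow> q ^ m \<noteq> 1"
begin

section \<open>Weights and Casimir values when q is not a root of unity\<close>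

lemma q_minus_inverse_nonzero: "q - inverse q \<noteq> 0"
  using q q_not_root[of 2] by (auto simp: field_simps power2_eq_square)

lemma q_square_power_eq_iff: "(q\<^sup>2) ^ i = (q\<^sup>2) ^ j \<longleftrightarrow> i = j"
proof -
  have less: "(q\<^sup>2) ^ i \<noteq> (q\<^sup>2) ^ j" if "i < j" for i j
  proof
    assume eq: "(q\<^sup>2) ^ i = (q\<^sup>2) ^ j"
    have "(q\<^sup>2) ^ j = (q\<^sup>2) ^ i * q ^ (2 * (j - i))"
      using that by (simp add: diff_mult_distrib2 flip: power_mult power_add)
    then have "q ^ (2 * (j - i)) = 1"
      using eq q by simp
    then show False
      using q_not_root[of "2 * (j - i)"] that by simp
  qed
  show ?thesis
    using less[of i j] less[of j i] by (cases i j rule: linorder_cases) auto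
qed

lemma finite_verma_weight:
  assumes "l \<noteq> 0"
  shows "finite {i. verma_weight q l i = \<omega>}"
proof -
  have "inj (verma_weight q l)"
    using assms q by (intro injI) (simp add: verma_weight_def divide_inverse q_square_power_eq_iff)
  from finite_vimageI[OF _ this, of "{\<omega>}"] show ?thesis
    by (simp add: vimage_def)
qed

text \<open>This is the commutator of e and f: on weight \<omega>, f e is C minus
  \<open>casimir_value q \<omega>\<close>, and e f is C minus the value at
  \<open>\<omega> / q\<^sup>2\<close>.\<close>

lemma casimir_value_diff:
  assumes "\<omega> \<noteq> 0"
  shows "casimir_value q \<omega> - casimir_value q (\<omega> / q\<^sup>2) = (\<omega> - inverse \<omega>) / (q - inverse q)"
proof -
  have "q * \<omega> + inverse (q * \<omega>) - (q * (\<omega> / q\<^sup>2) + inverse (q * (\<omega> / q\<^sup>2)))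
      = (\<omega> - inverse \<omega>) * (q - inverse q)"
    using q assms by (simp add: field_simps power2_eq_square)
  then show ?thesis
    using q_minus_inverse_nonzero
    by (simp add: casimir_value_def power2_eq_square flip: diff_divide_distrib)
qed

text \<open>Up to a nonzero denominator the difference of the values is
  \<open>(x - y) * (q\<^sup>2 * (x * y) - 1)\<close>. The second alternative is the reflection of
  \<open>x\<close> under the shifted Weyl group action.\<close>

lemma casimir_value_eq_iff:
  assumes "x \<noteq> 0" "y \<noteq> 0"
  shows "casimir_value q x = casimir_value q y \<longleftrightarrow> x = y \<or> q\<^sup>2 * (x * y) = 1"
proof -
  have "casimir_value q x - casimir_value q y
      = (x - y) * (q\<^sup>2 * (x * y) - 1) / (q * (x * y) * (q - inverse q)\<^sup>2)"
  proof -
    have "q * x + inverse (q * x) - (q * y + inverse (q * y)) = (x - y) * (q\<^sup>2 * (x * y) - 1) / (q * (x * y))"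
      using q assms by (simp add: field_simps power2_eq_square)
    then show ?thesis
      by (simp add: casimir_value_def flip: diff_divide_distrib)
  qed
  then have "casimir_value q x - casimir_value q y = 0 \<longleftrightarrow> x = y \<or> q\<^sup>2 * (x * y) = 1"
    using q assms q_minus_inverse_nonzero by simp
  then show ?thesis
    by simp
qed

lemma fe_coeff_Suc_diff:
  assumes "l \<noteq> 0"
  shows "fe_coeff q l (Suc i) - fe_coeff q l i
    = (verma_weight q l i - inverse (verma_weight q l i)) / (q - inverse q)"
  using casimir_value_diff[OF verma_weight_nonzero[OF q assms, of i]]
  by (simp add: fe_coeff_def verma_weight_Suc)

text \<open>Locates the singular basis vectors of M(l). The weight at depth \<open>Suc i\<close>
  differs from \<open>l\<close> because q is not a root of unity, so only the reflected weight can
  share its Casimir value.\<close>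

lemma fe_coeff_Suc_eq_0_iff:
  assumes "l \<noteq> 0"
  shows "fe_coeff q l (Suc i) = 0 \<longleftrightarrow> l\<^sup>2 = (q\<^sup>2) ^ i"
proof -
  have "l \<noteq> verma_weight q l (Suc i)"
    using assms q q_square_power_eq_iff[of 0 "Suc i"]
    by (auto simp: verma_weight_def eq_divide_eq)
  moreover have "q\<^sup>2 * (l * verma_weight q l (Suc i)) = 1 \<longleftrightarrow> l\<^sup>2 = (q\<^sup>2) ^ i"
    using q by (simp add: verma_weight_def field_simps power2_eq_square)
  ultimately show ?thesis
    using casimir_value_eq_iff[OF assms verma_weight_nonzero[OF q assms, of "Suc i"]]
    by (simp add: fe_coeff_def)
qed

text \<open>Puts the action into the shape also used by \<open>T_gen\<close>. At
  \<open>i = 0\<close> the index \<open>i - 1\<close> is junk, but its coefficient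
  \<open>fe_coeff q l 0\<close> is zero.\<close>

lemma verma_gen_simps:
  assumes "l \<noteq> 0"
  shows "verma_gen q l Gen_e i = Poly_Mapping.single (i - 1) (fe_coeff q l i)"
    "verma_gen q l Gen_t i = Poly_Mapping.single i (verma_weight q l i)"
    "verma_gen q l Gen_tinv i = Poly_Mapping.single i (inverse (verma_weight q l i))"
proof -
  define a where "a = q ^ i"
  have a: "a \<noteq> 0" "q ^ i = a" "q powi (- int i) = inverse a"
    "q powi (1 - int i) = q / a" "q powi (int i - 1) = a / q" "q powi (- 2 * int i) = inverse (a\<^sup>2)"
    "(q\<^sup>2) ^ i = a\<^sup>2"
    using q by (simp_all add: a_def power_int_diff power_int_minus power_int_mult power2_eq_square
        power_mult_distrib)
  have "(a - inverse a) * (q / a * l - a / q * inverse l)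
      = q * l + inverse (q * l) - (q * (l / a\<^sup>2) + inverse (q * (l / a\<^sup>2)))"
    using q assms a(1) by (simp add: field_simps power2_eq_square)
  then have "quantum_int q (int i) * ((q powi (1 - int i) * l - q powi (int i - 1) * inverse l) / (q - inverse q))
      = fe_coeff q l i"
    by (simp add: quantum_int_def fe_coeff_def casimir_value_def verma_weight_def a power2_eq_square[of "q - inverse q"]
        flip: diff_divide_distrib)
  then show "verma_gen q l Gen_e i = Poly_Mapping.single (i - 1) (fe_coeff q l i)"
    by (cases i) auto
  show "verma_gen q l Gen_t i = Poly_Mapping.single i (verma_weight q l i)"
    "verma_gen q l Gen_tinv i = Poly_Mapping.single i (inverse (verma_weight q l i))"
    by (simp_all only: verma_gen.simps a verma_weight_def) (simp_all add: divide_inverse mult.commute)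
qed

lemma verma_self_dual:
  assumes l: "l \<noteq> 0" and l_not: "\<And>n. l \<noteq> q ^ n" "\<And>n. l \<noteq> - (q ^ n)"
  shows "isomorphic_left_modules (Uq q) (sigma_dual q (verma q l)) (verma q l)"
proof -
  have q2: "q\<^sup>2 \<noteq> 1"
    using q_not_root[of 2] by simp
  have verma_simps: "carrier (verma q l) = UNIV" "x \<oplus>\<^bsub>verma q l\<^esub> y = x + y" for x y
    by (simp_all add: verma_def)
  have nz: "fe_coeff q l (Suc i) \<noteq> 0" for i
  proof -
    have "l\<^sup>2 \<noteq> (q ^ i)\<^sup>2"
      using l_not[of i] by (simp add: power2_eq_iff)
    then show ?thesis
      using fe_coeff_Suc_eq_0_iff[OF l] by (simp add: power_mult[symmetric] mult.commute)
  qed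
  \<comment> \<open>Contravariance forces \<open>h (Suc i) = fe_coeff q l (Suc i) * h i\<close>. By
    \<open>nz\<close> the diagonal Gram matrix is invertible, which yields the dual basis
    below.\<close>
  define h where "h i = (\<Prod>k<i. fe_coeff q l (Suc k))" for i
  have h: "h i \<noteq> 0" for i
    by (simp add: h_def nz)
  show ?thesis
  proof (rule self_dual_if_contravariant_form[where \<pi> = "\<lambda>p. p" and \<rho> = "verma_gen q l"
        and wt = "verma_weight q l" and b = "\<lambda>i j. if i = j then h i else 0"
        and \<gamma> = "\<lambda>i. Poly_Mapping.single i (inverse (h i))"])
    show "pm_dot (verma_gen q l Gen_e i) (\<lambda>k. if j = k then h j else 0)
        = pm_dot (verma_gen q l Gen_f j) (\<lambda>k. if i = k then h i else 0)" for i j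
      by (cases i) (auto simp: verma_gen_simps[OF l] h_def simp del: verma_gen.simps(1))
  qed (use q l q2 h in \<open>auto simp: left_module_verma verma_smult_class verma_free_const verma_free_gen
      verma_gen_simps finite_verma_weight verma_weight_nonzero verma_simps bij_betw_def simp del: verma_gen.simps(1,3,4)
      split: if_splits\<close>)
qed

end

section \<open>A model of the T modules\<close>

lemma casimir_altdef:
  "casimir q = gen Gen_f * gen Gen_e
    + pm_scale (1 / (q - inverse q)\<^sup>2) (pm_scale q (gen Gen_t) + pm_scale (inverse q) (gen Gen_tinv))"
  by (simp add: casimir_def const_mult add.commute)

text \<open>The analogue of \<open>verma_free\<close> for arbitrary matrices \<open>\<rho>\<close>
  of the generators. It is an action of the free algebra whatever \<open>\<rho>\<close> is; the
  relations of U_q are checked separately.\<close>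

definition free_act ::
  "(uq_gen \<Rightarrow> 'i \<Rightarrow> ('i \<Rightarrow>\<^sub>0 'k)) \<Rightarrow> 'k::field free_alg \<Rightarrow> ('i \<Rightarrow>\<^sub>0 'k) \<Rightarrow> ('i \<Rightarrow>\<^sub>0 'k)" where
  "free_act \<rho> x p = pm_extend (\<lambda>w. foldr (\<lambda>g. pm_extend (\<rho> g)) (letters w) p) x"

lemma foldr_pm_extend_linear:
  "foldr (\<lambda>g. pm_extend (\<rho> g)) gs (p + p')
    = foldr (\<lambda>g. pm_extend (\<rho> g)) gs p + foldr (\<lambda>g. pm_extend (\<rho> g)) gs p'"
  "foldr (\<lambda>g. pm_extend (\<rho> g)) gs (pm_scale c p) = pm_scale c (foldr (\<lambda>g. pm_extend (\<rho> g)) gs p)"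
  by (induction gs) (simp_all add: pm_extend_add pm_extend_scale)

lemma free_act_linear:
  "free_act \<rho> x (p + p') = free_act \<rho> x p + free_act \<rho> x p'"
  "free_act \<rho> x (pm_scale c p) = pm_scale c (free_act \<rho> x p)"
  "free_act \<rho> (x + y) p = free_act \<rho> x p + free_act \<rho> y p"
  "free_act \<rho> (x - y) p = free_act \<rho> x p - free_act \<rho> y p"
  "free_act \<rho> (pm_scale c x) p = pm_scale c (free_act \<rho> x p)"
proof -
  show "free_act \<rho> x (p + p') = free_act \<rho> x p + free_act \<rho> x p'"
    "free_act \<rho> x (pm_scale c p) = pm_scale c (free_act \<rho> x p)"
    by (simp_all add: free_act_def pm_extend_def foldr_pm_extend_linear pm_scale_add pm_scale_scale
        pm_scale_sum sum.distrib mult.commute)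
qed (simp_all add: free_act_def pm_extend_add pm_extend_minus pm_extend_scale)

lemma free_act_0 [simp]: "free_act \<rho> x 0 = 0" "free_act \<rho> 0 p = 0"
  using free_act_linear(2)[of \<rho> x 0] by (simp_all add: free_act_def)

lemma free_act_gen [simp]:
  "free_act \<rho> (Poly_Mapping.single (Word [g]) c) p = pm_scale c (pm_extend (\<rho> g) p)"
  by (simp add: free_act_def)

lemma free_act_const [simp]: "free_act \<rho> (const c) p = pm_scale c p"
  by (simp add: free_act_def zero_uq_word_def)

lemma free_act_one [simp]: "free_act \<rho> 1 p = p"
  using free_act_const[of \<rho> 1 p] by simp

lemma free_act_mult: "free_act \<rho> (x * y) p = free_act \<rho> x (free_act \<rho> y p)"
proof (induction x rule: pm_induct)
  case (single v c)
  show ?case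
  proof (induction y rule: pm_induct)
    case (single w d)
    show ?case
      by (simp add: mult_single free_act_def foldr_pm_extend_linear pm_scale_scale plus_uq_word_def)
  qed (simp add: algebra_simps free_act_linear)
qed (simp add: algebra_simps free_act_linear)

text \<open>The elements acting by zero form a two-sided ideal, so it suffices to test the relators
  on basis vectors.\<close>

lemma free_act_uq_ideal:
  assumes "\<And>r i. r \<in> uq_relators q \<Longrightarrow> free_act \<rho> r (Poly_Mapping.single i 1) = 0" "x \<in> uq_ideal q"
  shows "free_act \<rho> x p = 0"
proof -
  have "free_act \<rho> r p = 0" if "r \<in> uq_relators q" for r p
  proof (induction p rule: pm_induct)
    case (single i c)
    then show ?case
      using assms(1)[OF that, of i] free_act_linear(2)[of \<rho> r c "Poly_Mapping.single i 1"] by simp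
  qed (simp add: free_act_linear)
  then have "uq_ideal q \<subseteq> {x. \<forall>p. free_act \<rho> x p = 0}"
    by (intro uq_ideal_minimal) (auto simp: free_act_linear free_act_mult)
  then show ?thesis
    using assms(2) by blast
qed

text \<open>\<open>T(n,\<epsilon>)\<close> is an extension of the Verma module \<open>M(\<epsilon> q\<^bsup>-n-2\<^esup>)\<close> with basis \<open>Inr j\<close> by the Verma
  module \<open>M(\<epsilon> q\<^bsup>n\<^esup>)\<close> with basis \<open>Inl i\<close>: the cyclic generator is \<open>Inr 0\<close>, of the same weight as
  the singular vector \<open>Inl (n + 1)\<close>. Here \<open>l = \<epsilon> q\<^bsup>n\<^esup>\<close>. At \<open>i = 0\<close> and \<open>j = 0\<close> the coefficients of the
  vectors with the junk index \<open>0 - 1\<close> vanish.\<close>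

fun T_weight :: "'k::field \<Rightarrow> 'k \<Rightarrow> nat \<Rightarrow> nat + nat \<Rightarrow> 'k" where
  "T_weight q l n (Inl i) = verma_weight q l i"
| "T_weight q l n (Inr j) = verma_weight q l (Suc (n + j))"

fun T_gen :: "'k::field \<Rightarrow> 'k \<Rightarrow> nat \<Rightarrow> uq_gen \<Rightarrow> nat + nat \<Rightarrow> (nat + nat \<Rightarrow>\<^sub>0 'k)" where
  "T_gen q l n Gen_e (Inl i) = Poly_Mapping.single (Inl (i - 1)) (fe_coeff q l i)"
| "T_gen q l n Gen_e (Inr j) = Poly_Mapping.single (Inr (j - 1)) (fe_coeff q l (Suc (n + j)))
     + Poly_Mapping.single (Inl (n + j)) 1"
| "T_gen q l n Gen_f (Inl i) = Poly_Mapping.single (Inl (Suc i)) 1"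
| "T_gen q l n Gen_f (Inr j) = Poly_Mapping.single (Inr (Suc j)) 1"
| "T_gen q l n Gen_t b = Poly_Mapping.single b (T_weight q l n b)"
| "T_gen q l n Gen_tinv b = Poly_Mapping.single b (inverse (T_weight q l n b))"

text \<open>Applying f after e produces the index \<open>Suc (i - 1)\<close>, which is wrong only at
  \<open>i = 0\<close>, where the coefficient vanishes.\<close>

lemma single_Suc_minus:
  "\<lbrakk>i = 0 \<Longrightarrow> c = 0\<rbrakk> \<Longrightarrow> Poly_Mapping.single (g (Suc (i - Suc 0))) c = Poly_Mapping.single (g i) (c::'a::zero)"
  by (cases i) auto

text \<open>The condition on \<open>l\<close> encodes l = \<epsilon> q^n with \<epsilon> = 1 or -1,
  so both signs are treated at once.\<close>

locale T_params =
  fixes q :: "'k::field" and l :: 'k and n :: nat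
  assumes q: "q \<noteq> 0" and q_not_root: "\<And>m::nat. m > 0 \<Longrightarrow> q ^ m \<noteq> 1"
    and l: "l\<^sup>2 = (q\<^sup>2) ^ n"
begin

lemma l_nonzero: "l \<noteq> 0"
  using l q by auto

text \<open>The two zeros are the highest weight vector and the singular vector at depth
  \<open>Suc n\<close>. All inverses of norms and coefficients taken below rely on there being no
  others.\<close>

lemma fe_coeff_eq_0_iff: "fe_coeff q l i = 0 \<longleftrightarrow> i = 0 \<or> i = Suc n"
proof (cases i)
  case (Suc k)
  then show ?thesis
    using fe_coeff_Suc_eq_0_iff[OF q q_not_root l_nonzero, of k] q_square_power_eq_iff[OF q q_not_root, of n k] l
    by auto
qed simp

lemma T_weight_nonzero: "T_weight q l n b \<noteq> 0"
  using verma_weight_nonzero[OF q l_nonzero] by (cases b) auto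

lemma finite_T_weight: "finite {b. T_weight q l n b = \<omega>}"
proof -
  let ?F = "{i. verma_weight q l i = \<omega>}"
  have fin: "finite ?F"
    by (rule finite_verma_weight[OF q q_not_root l_nonzero])
  have "finite ((\<lambda>j. Suc (n + j)) -` ?F)"
    by (rule finite_vimageI[OF fin]) (auto intro: injI)
  moreover have "{b. T_weight q l n b = \<omega>} \<subseteq> Inl ` ?F \<union> Inr ` ((\<lambda>j. Suc (n + j)) -` ?F)"
  proof
    fix b assume "b \<in> {b. T_weight q l n b = \<omega>}"
    then show "b \<in> Inl ` ?F \<union> Inr ` ((\<lambda>j. Suc (n + j)) -` ?F)"
      by (cases b) auto
  qed
  ultimately show ?thesis
    using fin finite_subset by blast
qed

section \<open>The model satisfies the relations of U_q\<close>

abbreviation act :: "'k free_alg \<Rightarrow> (nat + nat \<Rightarrow>\<^sub>0 'k) \<Rightarrow> (nat + nat \<Rightarrow>\<^sub>0 'k)" where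
  "act \<equiv> free_act (T_gen q l n)"

lemma act_uq_relators:
  assumes r: "r \<in> uq_relators q"
  shows "act r (Poly_Mapping.single b 1) = 0"
proof -
  note simps = free_act_linear free_act_mult const_mult pm_extend_add pm_scale_add
  note nz = T_weight_nonzero verma_weight_nonzero[OF q l_nonzero]
  consider "r = gen Gen_t * gen Gen_tinv - 1" | "r = gen Gen_tinv * gen Gen_t - 1"
    | "r = gen Gen_t * gen Gen_e * gen Gen_tinv - const (q\<^sup>2) * gen Gen_e"
    | "r = gen Gen_t * gen Gen_f * gen Gen_tinv - const (inverse (q\<^sup>2)) * gen Gen_f"
    | "r = gen Gen_e * gen Gen_f - gen Gen_f * gen Gen_e
         - const (1 / (q - inverse q)) * (gen Gen_t - gen Gen_tinv)"
    using r by (auto simp: uq_relators_def)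
  then show ?thesis
  proof cases
    case 3
    \<comment> \<open>The junk indices at \<open>i = 0\<close> and \<open>j = 0\<close> carry the
      wrong weight, but both sides vanish there because of the coefficient.\<close>
    have "verma_weight q l (i - 1) * fe_coeff q l i = q\<^sup>2 * verma_weight q l i * fe_coeff q l i" for i
      using q by (cases i) (simp_all add: verma_weight_Suc)
    moreover have "verma_weight q l (Suc (n + (j - 1))) * fe_coeff q l (Suc (n + j))
        = q\<^sup>2 * verma_weight q l (Suc (n + j)) * fe_coeff q l (Suc (n + j))" for j
    proof (cases j)
      case 0
      have "fe_coeff q l (Suc n) = 0"
        by (simp add: fe_coeff_eq_0_iff)
      with 0 show ?thesis by simp
    next
      case (Suc k)
      then show ?thesis
        using q verma_weight_Suc[of q l "Suc (n + k)"] by simp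
    qed
    ultimately show ?thesis
      using nz q unfolding 3
      by (cases b) (simp_all add: simps verma_weight_Suc field_simps,
          (rule arg_cong[of _ _ "Poly_Mapping.single _"], auto simp: field_simps)+)
  next
    case 4
    then show ?thesis
      using nz q by (cases b) (simp_all add: simps verma_weight_Suc,
          (rule arg_cong[of _ _ "Poly_Mapping.single _"], simp add: field_simps)+)
  next
    case 5
    have "fe_coeff q l (Suc i) = fe_coeff q l i
        + (verma_weight q l i - inverse (verma_weight q l i)) / (q - inverse q)" for i
      using fe_coeff_Suc_diff[OF q q_not_root l_nonzero, of i] by (simp add: algebra_simps)
    note rec = this
    show ?thesis
    proof (cases b)
      case (Inl i)
      then show ?thesis
        unfolding 5
        by (simp add: simps single_Suc_minus[of _ _ Inl] rec[of i] diff_divide_distrib single_add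
            single_diff pm_scale_diff right_diff_distrib)
    next
      \<comment> \<open>The extra terms of e f and f e are both \<open>Inl (Suc (n + j))\<close> and
        cancel, so the recursion of the Verma case suffices.\<close>
      case (Inr j)
      then show ?thesis
        unfolding 5
        by (simp add: simps single_Suc_minus[of _ _ Inr] fe_coeff_eq_0_iff rec[of "Suc (n + j)"]
            diff_divide_distrib single_add single_diff pm_scale_diff right_diff_distrib)
    qed
  qed (use nz in \<open>simp_all add: simps\<close>)
qed

lemma act_uq_ideal: "x \<in> uq_ideal q \<Longrightarrow> act x p = 0"
  using free_act_uq_ideal[OF act_uq_relators] by blast

lemma act_f_power:
  "act (gen Gen_f ^ k) (Poly_Mapping.single (Inl i) c) = Poly_Mapping.single (Inl (k + i)) c"
  "act (gen Gen_f ^ k) (Poly_Mapping.single (Inr i) c) = Poly_Mapping.single (Inr (k + i)) c"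
  by (induction k) (simp_all add: free_act_mult)

lemma act_e_power:
  "act (gen Gen_e ^ k) (Poly_Mapping.single (Inl (k + i)) c)
    = Poly_Mapping.single (Inl i) (c * (\<Prod>j<k. fe_coeff q l (Suc (i + j))))"
proof (induction k arbitrary: c)
  case (Suc k)
  show ?case
    using Suc[of "c * fe_coeff q l (Suc (k + i))"]
    by (simp add: free_act_mult power_Suc2 add.commute mult_ac del: power_Suc)
qed simp

text \<open>Splitting \<open>casimir_value q l\<close> at the weight of the basis vector cancels
  everything except the off-diagonal part of e. In particular the shifted Casimir element squares to
  zero on the model.\<close>

lemma act_casimir:
  "act (casimir q - const (casimir_value q l)) (Poly_Mapping.single (Inl i) 1) = 0"
  "act (casimir q - const (casimir_value q l)) (Poly_Mapping.single (Inr j) 1)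
    = Poly_Mapping.single (Inl (Suc (n + j))) 1"
proof -
  have eq: "casimir_value q l = fe_coeff q l i
      + 1 / (q - inverse q)\<^sup>2 * (q * verma_weight q l i + inverse q * inverse (verma_weight q l i))" for i
    by (simp add: fe_coeff_def casimir_value_def)
  show "act (casimir q - const (casimir_value q l)) (Poly_Mapping.single (Inl i) 1) = 0"
    by (subst eq[of i]) (simp add: casimir_def free_act_linear free_act_mult const_mult single_add
        single_Suc_minus[of _ _ Inl] pm_scale_add algebra_simps)
  show "act (casimir q - const (casimir_value q l)) (Poly_Mapping.single (Inr j) 1)
      = Poly_Mapping.single (Inl (Suc (n + j))) 1"
    by (subst eq[of "Suc (n + j)"]) (simp add: casimir_def free_act_linear free_act_mult const_mult single_add
        single_Suc_minus[of _ _ Inr] fe_coeff_eq_0_iff pm_extend_add pm_scale_add algebra_simps)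
qed

end

section \<open>Weight vectors modulo a left ideal\<close>

text \<open>A left ideal of U_q is replaced by its preimage \<open>J\<close> in the free algebra, so
  that computations are congruences between noncommutative polynomials instead of equations between
  cosets.\<close>

locale uq_left_ideal =
  fixes q :: "'k::field" and J :: "'k free_alg set"
  assumes q: "q \<noteq> 0" and q_not_root: "\<And>m::nat. m > 0 \<Longrightarrow> q ^ m \<noteq> 1"
    and J_add: "x \<in> J \<Longrightarrow> y \<in> J \<Longrightarrow> x + y \<in> J"
    and J_mult: "x \<in> J \<Longrightarrow> y * x \<in> J"
    and uq_ideal_subset: "uq_ideal q \<subseteq> J"
begin

definition eqv :: "'k free_alg \<Rightarrow> 'k free_alg \<Rightarrow> bool" (infix "\<asymp>" 50) where
  "x \<asymp> y \<longleftrightarrow> x - y \<in> J"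

text \<open>Elements of \<open>J\<close> have every nonzero weight; only
  \<open>\<omega> \<noteq> 0\<close> is demanded, so that the inverse of t acts by
  \<open>inverse \<omega>\<close>.\<close>

definition has_weight :: "'k free_alg \<Rightarrow> 'k \<Rightarrow> bool" where
  "has_weight x \<omega> \<longleftrightarrow> \<omega> \<noteq> 0 \<and> gen Gen_t * x \<asymp> pm_scale \<omega> x"

section \<open>Calculus of congruences modulo the left ideal\<close>

lemma eqv_refl [simp]: "x \<asymp> x"
  using uq_ideal_subset uq_ideal_closed(1) by (auto simp: eqv_def)

lemma eqv_sym: "x \<asymp> y \<Longrightarrow> y \<asymp> x"
  unfolding eqv_def using J_mult[of "x - y" "-1"] by simp

lemma eqv_trans [trans]: "x \<asymp> y \<Longrightarrow> y \<asymp> z \<Longrightarrow> x \<asymp> z"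
  unfolding eqv_def using J_add[of "x - y" "y - z"] by simp

lemma eqv_mult: "x \<asymp> y \<Longrightarrow> z * x \<asymp> z * y"
  unfolding eqv_def using J_mult[of "x - y" z] by (simp add: algebra_simps)

lemma eqv_add: "x \<asymp> y \<Longrightarrow> x' \<asymp> y' \<Longrightarrow> x + x' \<asymp> y + y'"
  unfolding eqv_def using J_add[of "x - y" "x' - y'"] by (simp add: algebra_simps)

lemma eqv_scale: "x \<asymp> y \<Longrightarrow> pm_scale c x \<asymp> pm_scale c y"
  using eqv_mult[of x y "const c"] by (simp add: const_mult)

lemma eqv_diff: "x \<asymp> y \<Longrightarrow> x' \<asymp> y' \<Longrightarrow> x - x' \<asymp> y - y'"
  using eqv_add[of x y "- x'" "- y'"] eqv_mult[of x' y' "-1"] by simp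

text \<open>Congruences in general survive only left multiplication; those coming from the two-sided
  ideal of relations may also be multiplied on the right.\<close>

lemma eqv_uq_ideal: "x - y \<in> uq_ideal q \<Longrightarrow> x * z \<asymp> y * z"
  using uq_ideal_closed(5)[of "x - y" q z] uq_ideal_subset by (auto simp: eqv_def algebra_simps)

lemma eqv_scale_cancel: "pm_scale c x \<asymp> 0 \<Longrightarrow> c \<noteq> 0 \<Longrightarrow> x \<asymp> 0"
  using eqv_scale[of "pm_scale c x" 0 "inverse c"] by (simp add: pm_scale_scale)

lemma tinv_t: "gen Gen_tinv * (gen Gen_t * x) \<asymp> x"
  using eqv_uq_ideal[of "gen Gen_tinv * gen Gen_t" 1 x] uq_relators_subset[of q]
  by (auto simp: uq_relators_def mult.assoc)

text \<open>Insert \<open>gen Gen_tinv * gen Gen_t\<close> between \<open>y\<close> and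
  \<open>x\<close> and apply the relation to the left factor.\<close>

lemma t_conj:
  assumes "gen Gen_t * y * gen Gen_tinv - const c * y \<in> uq_ideal q"
  shows "gen Gen_t * (y * x) \<asymp> pm_scale c (y * (gen Gen_t * x))"
proof -
  have "gen Gen_t * (y * x) \<asymp> gen Gen_t * (y * (gen Gen_tinv * (gen Gen_t * x)))"
    by (intro eqv_mult eqv_sym[OF tinv_t])
  also have "\<dots> \<asymp> pm_scale c (y * (gen Gen_t * x))"
    using eqv_uq_ideal[OF assms, of "gen Gen_t * x"] by (simp add: const_mult pm_scale_mult mult.assoc)
  finally show ?thesis .
qed

section \<open>Weights and the shifted Casimir element\<close>

lemma has_weight_gen_e:
  assumes "has_weight x \<omega>"
  shows "has_weight (gen Gen_e * x) (q\<^sup>2 * \<omega>)"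
proof -
  have "gen Gen_t * gen Gen_e * gen Gen_tinv - const (q\<^sup>2) * gen Gen_e \<in> uq_ideal q"
    using uq_relators_subset[of q] by (auto simp: uq_relators_def)
  from t_conj[OF this, of x]
  have "gen Gen_t * (gen Gen_e * x) \<asymp> pm_scale (q\<^sup>2) (gen Gen_e * (gen Gen_t * x))" .
  also have "\<dots> \<asymp> pm_scale (q\<^sup>2) (gen Gen_e * pm_scale \<omega> x)"
    using assms by (intro eqv_scale eqv_mult) (simp add: has_weight_def)
  finally show ?thesis
    using assms q by (simp add: has_weight_def pm_scale_scale pm_scale_mult)
qed

lemma has_weight_gen_f:
  assumes "has_weight x \<omega>"
  shows "has_weight (gen Gen_f * x) (\<omega> / q\<^sup>2)"
proof -
  have "gen Gen_t * gen Gen_f * gen Gen_tinv - const (inverse (q\<^sup>2)) * gen Gen_f \<in> uq_ideal q"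
    using uq_relators_subset[of q] by (auto simp: uq_relators_def)
  from t_conj[OF this, of x]
  have "gen Gen_t * (gen Gen_f * x) \<asymp> pm_scale (inverse (q\<^sup>2)) (gen Gen_f * (gen Gen_t * x))" .
  also have "\<dots> \<asymp> pm_scale (inverse (q\<^sup>2)) (gen Gen_f * pm_scale \<omega> x)"
    using assms by (intro eqv_scale eqv_mult) (simp add: has_weight_def)
  finally show ?thesis
    using assms q by (simp add: has_weight_def pm_scale_scale pm_scale_mult divide_inverse mult.commute)
qed

lemma has_weight_scale: "has_weight x \<omega> \<Longrightarrow> has_weight (pm_scale c x) \<omega>"
  using eqv_scale[of "gen Gen_t * x" "pm_scale \<omega> x" c]
  by (simp add: has_weight_def pm_scale_scale pm_scale_mult mult.commute)

lemma has_weight_eqv: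
  assumes "has_weight x \<omega>" "x \<asymp> y"
  shows "has_weight y \<omega>"
proof -
  have "gen Gen_t * y \<asymp> gen Gen_t * x"
    by (rule eqv_mult[OF eqv_sym[OF assms(2)]])
  also have "\<dots> \<asymp> pm_scale \<omega> x"
    using assms by (simp add: has_weight_def)
  also have "\<dots> \<asymp> pm_scale \<omega> y"
    using assms by (intro eqv_scale)
  finally show ?thesis
    using assms by (simp add: has_weight_def)
qed

lemma has_weight_diff: "has_weight x \<omega> \<Longrightarrow> has_weight y \<omega> \<Longrightarrow> has_weight (x - y) \<omega>"
  using eqv_diff[of "gen Gen_t * x" "pm_scale \<omega> x" "gen Gen_t * y" "pm_scale \<omega> y"]
  by (simp add: has_weight_def pm_scale_diff right_diff_distrib)

lemma tinv_weight:
  assumes "has_weight x \<omega>"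
  shows "gen Gen_tinv * x \<asymp> pm_scale (inverse \<omega>) x"
proof -
  have "x \<asymp> gen Gen_tinv * pm_scale \<omega> x"
    using assms by (intro eqv_trans[OF eqv_sym[OF tinv_t] eqv_mult]) (simp add: has_weight_def)
  from eqv_scale[OF this, of "inverse \<omega>"] show ?thesis
    using assms by (simp add: has_weight_def pm_scale_scale pm_scale_mult eqv_sym)
qed

text \<open>The element \<nu> of the overview as an element of the free algebra. That its square
  vanishes is assumed only in \<open>T_ideal_params\<close>.\<close>

definition nilp :: "'k \<Rightarrow> 'k free_alg" where
  "nilp l = casimir q - const (casimir_value q l)"

text \<open>The definition of the Casimir element solved for f e, with t and its inverse replaced by
  scalars.\<close>

lemma f_e_weight:
  assumes "has_weight x \<omega>"
  shows "gen Gen_f * (gen Gen_e * x)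
    \<asymp> nilp l * x + pm_scale (casimir_value q l - casimir_value q \<omega>) x"
proof -
  let ?d = "1 / (q - inverse q)\<^sup>2"
  have "nilp l * x = gen Gen_f * (gen Gen_e * x)
      + pm_scale ?d (pm_scale q (gen Gen_t * x) + pm_scale (inverse q) (gen Gen_tinv * x))
      - pm_scale (casimir_value q l) x"
    by (simp add: nilp_def casimir_altdef const_mult pm_scale_mult algebra_simps del: pm_scale_single)
  also have "\<dots> \<asymp> gen Gen_f * (gen Gen_e * x)
      + pm_scale ?d (pm_scale q (pm_scale \<omega> x) + pm_scale (inverse q) (pm_scale (inverse \<omega>) x))
      - pm_scale (casimir_value q l) x"
    using assms tinv_weight[OF assms]
    by (intro eqv_diff eqv_add eqv_scale eqv_refl) (simp_all add: has_weight_def)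
  also have "pm_scale ?d (pm_scale q (pm_scale \<omega> x) + pm_scale (inverse q) (pm_scale (inverse \<omega>) x))
      = pm_scale (casimir_value q \<omega>) x"
    by (simp add: pm_scale_scale casimir_value_def flip: pm_scale_add_left)
  finally have "nilp l * x + pm_scale (casimir_value q l - casimir_value q \<omega>) x
    \<asymp> gen Gen_f * (gen Gen_e * x) + pm_scale (casimir_value q \<omega>) x - pm_scale (casimir_value q l) x
      + pm_scale (casimir_value q l - casimir_value q \<omega>) x"
    by (intro eqv_add eqv_refl)
  also have "\<dots> = gen Gen_f * (gen Gen_e * x)"
    by (rule poly_mapping_eqI) (simp add: lookup_add lookup_minus algebra_simps)
  finally show ?thesis
    by (rule eqv_sym)
qed

text \<open>The commutator relation changes the scalar of \<open>f_e_weight\<close> by exactly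
  \<open>casimir_value_diff\<close>.\<close>

lemma e_f_weight:
  assumes "has_weight x \<omega>"
  shows "gen Gen_e * (gen Gen_f * x)
    \<asymp> nilp l * x + pm_scale (casimir_value q l - casimir_value q (\<omega> / q\<^sup>2)) x"
proof -
  let ?d = "1 / (q - inverse q)"
  have "gen Gen_e * gen Gen_f - (gen Gen_f * gen Gen_e + const ?d * (gen Gen_t - gen Gen_tinv)) \<in> uq_ideal q"
    using uq_relators_subset[of q] by (auto simp: uq_relators_def algebra_simps)
  from eqv_uq_ideal[OF this, of x]
  have "gen Gen_e * (gen Gen_f * x)
      \<asymp> gen Gen_f * (gen Gen_e * x) + pm_scale ?d (gen Gen_t * x - gen Gen_tinv * x)"
    by (simp add: const_mult pm_scale_mult pm_scale_diff algebra_simps del: pm_scale_single)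
  also have "\<dots> \<asymp> nilp l * x + pm_scale (casimir_value q l - casimir_value q \<omega>) x
      + pm_scale ?d (pm_scale \<omega> x - pm_scale (inverse \<omega>) x)"
    using assms by (intro eqv_add eqv_diff eqv_scale f_e_weight tinv_weight) (simp_all add: has_weight_def)
  also have "\<dots> = nilp l * x + pm_scale (casimir_value q l - casimir_value q \<omega>
      + (\<omega> - inverse \<omega>) / (q - inverse q)) x"
    by (rule poly_mapping_eqI)
      (simp add: lookup_add lookup_minus algebra_simps diff_divide_distrib)
  also have "\<dots> = nilp l * x + pm_scale (casimir_value q l - casimir_value q (\<omega> / q\<^sup>2)) x"
    using casimir_value_diff[OF q q_not_root, of \<omega>] assms by (simp add: has_weight_def algebra_simps)
  finally show ?thesis .
qed

text \<open>Modulo \<open>J\<close>, \<open>nilp l * x\<close> is f e x minus a multiple of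
  \<open>x\<close>, and f e preserves weights.\<close>

lemma has_weight_nilp:
  assumes "has_weight x \<omega>"
  shows "has_weight (nilp l * x) \<omega>"
proof -
  let ?c = "casimir_value q l - casimir_value q \<omega>"
  have "has_weight (gen Gen_f * (gen Gen_e * x) - pm_scale ?c x) \<omega>"
    using has_weight_gen_f[OF has_weight_gen_e[OF assms]] q
    by (intro has_weight_diff has_weight_scale assms) simp
  moreover have "gen Gen_f * (gen Gen_e * x) - pm_scale ?c x \<asymp> nilp l * x + pm_scale ?c x - pm_scale ?c x"
    by (intro eqv_diff eqv_refl f_e_weight assms)
  ultimately show ?thesis
    using has_weight_eqv by simp
qed

text \<open>The Casimir element is central; on weight vectors this follows by reading \<open>e f e\<close> and
  \<open>f e f\<close> in two ways.\<close>

lemma nilp_e: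
  assumes "has_weight x \<omega>"
  shows "nilp l * (gen Gen_e * x) \<asymp> gen Gen_e * (nilp l * x)"
proof -
  let ?c = "casimir_value q l - casimir_value q \<omega>" and ?e = "gen Gen_e" and ?f = "gen Gen_f"
  \<comment> \<open>The scalar of e f at weight \<open>q\<^sup>2 * \<omega>\<close> is that of f e
    at weight \<omega>, so the scalar terms cancel.\<close>
  have "nilp l * (?e * x) + pm_scale ?c (?e * x) \<asymp> ?e * (?f * (?e * x))"
    using e_f_weight[OF has_weight_gen_e[OF assms], of l] q by (simp add: eqv_sym)
  also have "\<dots> \<asymp> ?e * (nilp l * x + pm_scale ?c x)"
    by (intro eqv_mult f_e_weight assms)
  finally show ?thesis
    by (simp add: eqv_def pm_scale_mult algebra_simps)
qed

lemma nilp_f: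
  assumes "has_weight x \<omega>"
  shows "nilp l * (gen Gen_f * x) \<asymp> gen Gen_f * (nilp l * x)"
proof -
  let ?c = "casimir_value q l - casimir_value q (\<omega> / q\<^sup>2)" and ?e = "gen Gen_e" and ?f = "gen Gen_f"
  have "nilp l * (?f * x) + pm_scale ?c (?f * x) \<asymp> ?f * (?e * (?f * x))"
    by (rule eqv_sym[OF f_e_weight[OF has_weight_gen_f[OF assms]]])
  also have "\<dots> \<asymp> ?f * (nilp l * x + pm_scale ?c x)"
    by (intro eqv_mult e_f_weight assms)
  finally show ?thesis
    by (simp add: eqv_def pm_scale_mult algebra_simps)
qed

lemma has_weight_e_power: "has_weight x \<omega> \<Longrightarrow> has_weight (gen Gen_e ^ k * x) ((q\<^sup>2) ^ k * \<omega>)"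
  by (induction k) (auto simp: mult.assoc dest: has_weight_gen_e)

lemma has_weight_f_power: "has_weight x \<omega> \<Longrightarrow> has_weight (gen Gen_f ^ k * x) (\<omega> / (q\<^sup>2) ^ k)"
proof (induction k)
  case (Suc k)
  then show ?case
    using has_weight_gen_f[of "gen Gen_f ^ k * x" "\<omega> / (q\<^sup>2) ^ k"] by (simp add: mult.assoc mult.commute)
qed simp

lemma nilp_e_power:
  assumes "has_weight x \<omega>"
  shows "nilp l * (gen Gen_e ^ k * x) \<asymp> gen Gen_e ^ k * (nilp l * x)"
proof (induction k)
  case (Suc k)
  have "nilp l * (gen Gen_e * (gen Gen_e ^ k * x)) \<asymp> gen Gen_e * (nilp l * (gen Gen_e ^ k * x))"
    by (rule nilp_e[OF has_weight_e_power[OF assms]])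
  also have "\<dots> \<asymp> gen Gen_e * (gen Gen_e ^ k * (nilp l * x))"
    by (rule eqv_mult[OF Suc])
  finally show ?case by (simp add: mult.assoc)
qed simp

lemma nilp_f_power:
  assumes "has_weight x \<omega>"
  shows "nilp l * (gen Gen_f ^ k * x) \<asymp> gen Gen_f ^ k * (nilp l * x)"
proof (induction k)
  case (Suc k)
  have "nilp l * (gen Gen_f * (gen Gen_f ^ k * x)) \<asymp> gen Gen_f * (nilp l * (gen Gen_f ^ k * x))"
    by (rule nilp_f[OF has_weight_f_power[OF assms]])
  also have "\<dots> \<asymp> gen Gen_f * (gen Gen_f ^ k * (nilp l * x))"
    by (rule eqv_mult[OF Suc])
  finally show ?case by (simp add: mult.assoc)
qed simp

end

text \<open>The assumptions say that \<open>J\<close> contains representatives of the three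
  generators of the T ideal, with 1 as cyclic vector. They bound \<open>J\<close> from below only;
  the bound from above comes from the model.\<close>

locale T_ideal_params = T_params q l n + uq_left_ideal q J
  for q :: "'k::field" and l :: 'k and n :: nat and J +
  assumes weight_one: "has_weight 1 (verma_weight q l (Suc n))"
    and e_power_nil: "gen Gen_e ^ Suc (Suc n) \<asymp> 0"
    and nilp_nil: "nilp l * nilp l \<asymp> 0"
begin

section \<open>Relations in the quotient by the T ideal\<close>

lemma nilp_weight: "has_weight (nilp l) (verma_weight q l (Suc n))"
  using has_weight_nilp[OF weight_one, of l] by simp

lemma e_power_weight:
  assumes "k \<le> Suc n"
  shows "has_weight (gen Gen_e ^ k) (verma_weight q l (Suc n - k))"
proof -
  have "(q\<^sup>2) ^ Suc n = (q\<^sup>2) ^ k * (q\<^sup>2) ^ (Suc n - k)"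
    using assms by (simp flip: power_add)
  then have "(q\<^sup>2) ^ k * verma_weight q l (Suc n) = verma_weight q l (Suc n - k)"
    using q by (simp add: verma_weight_def del: power_Suc)
  then show ?thesis
    using has_weight_e_power[OF weight_one, of k] by simp
qed

lemma f_power_weight:
  assumes "has_weight x (verma_weight q l i)"
  shows "has_weight (gen Gen_f ^ k * x) (verma_weight q l (i + k))"
  using has_weight_f_power[OF assms, of k] by (simp add: verma_weight_def power_add)

lemma f_e:
  assumes "has_weight x (verma_weight q l i)"
  shows "gen Gen_f * (gen Gen_e * x) \<asymp> nilp l * x + pm_scale (fe_coeff q l i) x"
  using f_e_weight[OF assms, of l] by (simp add: fe_coeff_def)

lemma e_f:
  assumes "has_weight x (verma_weight q l i)"
  shows "gen Gen_e * (gen Gen_f * x) \<asymp> nilp l * x + pm_scale (fe_coeff q l (Suc i)) x"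
  using e_f_weight[OF assms, of l] by (simp add: fe_coeff_def verma_weight_Suc)

text \<open>Descending induction on \<open>k\<close>. For \<open>k = n\<close> the scalar in f e is
  zero, so \<nu> e^(n+1) is f e^(n+2), which vanishes.\<close>

lemma nilp_e_power_nil:
  assumes "k \<le> n"
  shows "nilp l * gen Gen_e ^ Suc k \<asymp> 0"
  using assms
proof (induction k rule: inc_induct)
  case base
  have "nilp l * gen Gen_e ^ Suc n \<asymp> gen Gen_f * (gen Gen_e * gen Gen_e ^ Suc n)"
    using f_e[OF e_power_weight[of "Suc n", simplified]] by (simp add: eqv_sym)
  also have "\<dots> \<asymp> gen Gen_f * 0"
    using e_power_nil by (intro eqv_mult) simp
  finally show ?case by simp
next
  case (step k)
  \<comment> \<open>Multiply f e E = \<nu> E + c E by \<nu>. The left side dies by induction since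
    \<nu> commutes with f, and \<nu>^2 E dies too; what remains is c \<nu> E with c nonzero, as 0 <
    n - k \<le> n.\<close>
  let ?E = "gen Gen_e ^ Suc k" and ?c = "fe_coeff q l (n - k)"
  have wt: "has_weight ?E (verma_weight q l (n - k))"
    using e_power_weight[of "Suc k"] step.hyps by simp
  have "pm_scale ?c (nilp l * ?E) \<asymp> nilp l * (gen Gen_f * (gen Gen_e * ?E)) - nilp l * (nilp l * ?E)"
    using eqv_mult[OF eqv_sym[OF f_e[OF wt]], of "nilp l"]
    by (simp add: eqv_def pm_scale_mult algebra_simps del: power_Suc)
  also have "\<dots> \<asymp> 0 - 0"
  proof (rule eqv_diff)
    have "nilp l * (gen Gen_f * (gen Gen_e * ?E)) \<asymp> gen Gen_f * (nilp l * (gen Gen_e * ?E))"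
      by (rule nilp_f[OF has_weight_gen_e[OF wt]])
    also have "\<dots> \<asymp> gen Gen_f * 0"
      using step.IH by (intro eqv_mult) simp
    finally show "nilp l * (gen Gen_f * (gen Gen_e * ?E)) \<asymp> 0" by simp
    have "nilp l * (nilp l * ?E) \<asymp> nilp l * (?E * nilp l)"
      using nilp_e_power[OF weight_one, of l "Suc k"] by (intro eqv_mult) simp
    also have "\<dots> \<asymp> ?E * (nilp l * nilp l)"
      using nilp_e_power[OF nilp_weight, of l "Suc k"] by simp
    also have "\<dots> \<asymp> ?E * 0"
      by (rule eqv_mult[OF nilp_nil])
    finally show "nilp l * (nilp l * ?E) \<asymp> 0" by simp
  qed
  finally have "pm_scale ?c (nilp l * ?E) \<asymp> 0"
    by simp
  then show ?case
    by (rule eqv_scale_cancel) (use step.hyps in \<open>auto simp: fe_coeff_eq_0_iff\<close>)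
qed

text \<open>Normalises e^(n+1-i) so that f maps each basis vector to the next with coefficient 1, as
  \<open>T_gen\<close> demands; the starting vector e itself, at \<open>i = n\<close>, is not
  rescaled.\<close>

definition e_coeff :: "nat \<Rightarrow> 'k" where
  "e_coeff i = inverse (\<Prod>k\<in>{i..<n}. fe_coeff q l (Suc k))"

lemma e_coeff_n [simp]: "e_coeff n = 1"
  by (simp add: e_coeff_def)

lemma e_coeff_Suc:
  assumes "i < n"
  shows "fe_coeff q l (Suc i) * e_coeff i = e_coeff (Suc i)"
proof -
  have "fe_coeff q l (Suc i) \<noteq> 0"
    using assms by (simp add: fe_coeff_eq_0_iff)
  then show ?thesis
    using assms by (simp add: e_coeff_def prod.atLeast_Suc_lessThan)
qed

text \<open>The chain of the \<open>Inl i\<close> runs through the powers of e up to e at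
  \<open>i = n\<close>, and goes on with f e, which is congruent to \<nu>, and its images under
  f.\<close>

fun lift_basis :: "nat + nat \<Rightarrow> 'k free_alg" where
  "lift_basis (Inl i) = (if i \<le> n then pm_scale (e_coeff i) (gen Gen_e ^ (Suc n - i))
     else gen Gen_f ^ (i - Suc n) * nilp l)"
| "lift_basis (Inr j) = gen Gen_f ^ j"

definition lift :: "(nat + nat \<Rightarrow>\<^sub>0 'k) \<Rightarrow> 'k free_alg" where
  "lift p = pm_extend lift_basis p"

lemma lift_simps [simp]:
  "lift (p + p') = lift p + lift p'" "lift (pm_scale c p) = pm_scale c (lift p)"
  "lift (Poly_Mapping.single b c) = pm_scale c (lift_basis b)" "lift 0 = 0"
  by (simp_all add: lift_def pm_extend_add pm_extend_scale)

lemma lift_basis_weight: "has_weight (lift_basis b) (T_weight q l n b)"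
proof (cases b)
  case (Inl i)
  show ?thesis
  proof (cases "i \<le> n")
    case True
    then show ?thesis
      using has_weight_scale[OF e_power_weight[of "Suc n - i"]] Inl by simp
  next
    case False
    then show ?thesis
      using f_power_weight[OF nilp_weight, of "i - Suc n"] Inl by simp
  qed
next
  case (Inr j)
  then show ?thesis
    using f_power_weight[OF weight_one, of j] by simp
qed

text \<open>Below \<open>n\<close> the \<nu>-part of f e vanishes on powers of e; at
  \<open>n\<close> the scalar part vanishes and \<nu> remains; above \<open>n\<close> one more
  factor f is prepended.\<close>

lemma f_lift_basis: "gen Gen_f * lift_basis b \<asymp> lift (T_gen q l n Gen_f b)"
proof (cases b)
  case (Inl i)
  consider "i < n" | "i = n" | "i > n" by linarith
  then show ?thesis
  proof cases
    case 1
    let ?E = "gen Gen_e ^ (n - i)"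
    have "gen Gen_f * (gen Gen_e * ?E) \<asymp> nilp l * ?E + pm_scale (fe_coeff q l (Suc i)) ?E"
      using f_e[OF e_power_weight[of "n - i"]] 1 by (simp add: Suc_diff_le)
    also have "\<dots> \<asymp> 0 + pm_scale (fe_coeff q l (Suc i)) ?E"
      using nilp_e_power_nil[of "n - Suc i"] 1
      by (intro eqv_add eqv_refl) (simp add: Suc_diff_Suc del: power_Suc)
    finally have "pm_scale (e_coeff i) (gen Gen_f * (gen Gen_e * ?E)) \<asymp>
        pm_scale (e_coeff i) (pm_scale (fe_coeff q l (Suc i)) ?E)"
      by (intro eqv_scale) simp
    moreover have "gen Gen_f * lift_basis b = pm_scale (e_coeff i) (gen Gen_f * (gen Gen_e * ?E))"
      using 1 Inl by (simp add: pm_scale_mult Suc_diff_le)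
    moreover have "lift (T_gen q l n Gen_f b) = pm_scale (e_coeff i) (pm_scale (fe_coeff q l (Suc i)) ?E)"
      using 1 Inl e_coeff_Suc[of i] by (simp add: pm_scale_scale mult.commute)
    ultimately show ?thesis by simp
  next
    case 2
    have "fe_coeff q l (Suc n) = 0"
      by (simp add: fe_coeff_eq_0_iff)
    then show ?thesis
      using 2 Inl f_e[OF weight_one] by simp
  next
    case 3
    then have "Suc i - Suc n = Suc (i - Suc n)"
      by simp
    then show ?thesis
      using 3 Inl by (simp add: mult.assoc del: diff_Suc_Suc)
  qed
qed (simp add: mult.assoc)

text \<open>On \<open>Inl i\<close> the special cases rest on e^(n+2) = 0 at the top, e \<nu> =
  \<nu> e = 0 at \<open>Suc n\<close>, and \<nu>^2 = 0 beyond. On \<open>Inr j\<close> the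
  \<nu>-part of e f gives the extra term in \<open>Inl\<close>.\<close>

lemma e_lift_basis: "gen Gen_e * lift_basis b \<asymp> lift (T_gen q l n Gen_e b)"
proof (cases b)
  case (Inl i)
  consider "i = 0" | k where "i = Suc k" "k < n" | "i = Suc n" | k where "i = Suc (Suc (n + k))"
    by (cases i) (auto dest!: less_imp_Suc_add, metis less_linear less_iff_Suc_add)
  then show ?thesis
  proof cases
    case 1
    then show ?thesis
      using eqv_scale[OF e_power_nil, of "e_coeff 0"] Inl by (simp add: pm_scale_mult)
  next
    case 2
    then have "gen Gen_e * lift_basis b = lift (T_gen q l n Gen_e b)"
      using Inl e_coeff_Suc[of k] by (simp add: pm_scale_mult pm_scale_scale Suc_diff_le)
    then show ?thesis by simp
  next
    case 3
    have "gen Gen_e * nilp l \<asymp> nilp l * gen Gen_e"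
      using nilp_e[OF weight_one] by (simp add: eqv_sym)
    also have "\<dots> \<asymp> 0"
      using nilp_e_power_nil[of 0] by simp
    finally have "gen Gen_e * nilp l \<asymp> 0" .
    moreover have "fe_coeff q l (Suc n) = 0"
      by (simp add: fe_coeff_eq_0_iff)
    ultimately show ?thesis
      using 3 Inl by simp
  next
    case 4
    let ?F = "gen Gen_f ^ k"
    have "gen Gen_e * (gen Gen_f * (?F * nilp l))
        \<asymp> nilp l * (?F * nilp l) + pm_scale (fe_coeff q l i) (?F * nilp l)"
      using e_f[OF f_power_weight[OF nilp_weight]] 4 by simp
    also have "\<dots> \<asymp> ?F * (nilp l * nilp l) + pm_scale (fe_coeff q l i) (?F * nilp l)"
      by (intro eqv_add eqv_refl nilp_f_power[OF nilp_weight])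
    also have "\<dots> \<asymp> ?F * 0 + pm_scale (fe_coeff q l i) (?F * nilp l)"
      by (intro eqv_add eqv_refl eqv_mult nilp_nil)
    finally show ?thesis
      using 4 Inl by (simp add: mult.assoc)
  qed
next
  case (Inr j)
  show ?thesis
  proof (cases j)
    case 0
    have "fe_coeff q l (Suc n) = 0"
      by (simp add: fe_coeff_eq_0_iff)
    then show ?thesis
      using 0 Inr by simp
  next
    case (Suc k)
    let ?F = "gen Gen_f ^ k"
    have "gen Gen_e * (gen Gen_f * ?F) \<asymp> nilp l * ?F + pm_scale (fe_coeff q l (Suc (n + j))) ?F"
      using e_f[OF f_power_weight[OF weight_one, of k]] Suc by simp
    also have "\<dots> \<asymp> ?F * nilp l + pm_scale (fe_coeff q l (Suc (n + j))) ?F"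
      using nilp_f_power[OF weight_one, of l k] by (intro eqv_add eqv_refl) simp
    finally show ?thesis
      using Suc Inr by (simp add: add.commute)
  qed
qed

section \<open>Spanning and linear independence of the expected basis\<close>

lemma gen_lift_basis: "gen g * lift_basis b \<asymp> lift (T_gen q l n g b)"
  using e_lift_basis f_lift_basis lift_basis_weight[of b] tinv_weight[OF lift_basis_weight[of b]]
  by (cases g) (simp_all add: has_weight_def)

text \<open>Constants, sums and products are formal, and generators are
  \<open>gen_lift_basis\<close>. As \<open>lift cyclic\<close> is 1, spanning follows in
  \<open>eqv_lift\<close>.\<close>

lemma mult_lift: "x * lift p \<asymp> lift (act x p)"
proof (induction x arbitrary: p rule: free_alg_induct)
  case (gen g)
  show ?case
  proof (induction p rule: pm_induct)
    case (single b c)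
    then show ?case
      using eqv_scale[OF gen_lift_basis[of g b], of c] by (simp add: pm_scale_mult)
  next
    case (add p p')
    then show ?case
      using eqv_add by (simp add: distrib_left pm_extend_add)
  qed
next
  case (add x y)
  then show ?case
    using eqv_add by (simp add: distrib_right free_act_linear)
next
  case (mult x y)
  have "x * (y * lift p) \<asymp> x * lift (act y p)"
    by (rule eqv_mult[OF mult(2)])
  also have "\<dots> \<asymp> lift (act x (act y p))"
    by (rule mult(1))
  finally show ?case
    by (simp add: mult.assoc free_act_mult)
qed (simp add: const_mult)

abbreviation cyclic :: "nat + nat \<Rightarrow>\<^sub>0 'k" where
  "cyclic \<equiv> Poly_Mapping.single (Inr 0) 1"

lemma eqv_lift: "x \<asymp> lift (act x cyclic)"
  using mult_lift[of x cyclic] by simp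

text \<open>The lifted basis applied to the cyclic vector of the model gives back the basis of the
  model; this is where independence comes from.\<close>

lemma act_lift: "act (lift p) cyclic = p"
proof (induction p rule: pm_induct)
  case (single b c)
  show ?case
  proof (cases b)
    case (Inl i)
    show ?thesis
    proof (cases "i \<le> n")
      case True
      have nz: "(\<Prod>k\<in>{i..<n}. fe_coeff q l (Suc k)) \<noteq> 0"
        by (auto simp: fe_coeff_eq_0_iff)
      \<comment> \<open>The component in \<open>Inr\<close> has coefficient
        \<open>fe_coeff q l (Suc n)\<close>, which is zero; this first e crosses from
        \<open>Inr\<close> to \<open>Inl\<close>.\<close>
      have e1: "act (gen Gen_e) cyclic = Poly_Mapping.single (Inl n) 1"
        using fe_coeff_eq_0_iff[of "Suc n"] by simp
      have "act (gen Gen_e ^ (Suc n - i)) cyclic = act (gen Gen_e ^ (n - i)) (act (gen Gen_e) cyclic)"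
        using True by (simp only: Suc_diff_le power_Suc2 free_act_mult)
      also have "\<dots> = Poly_Mapping.single (Inl i) (\<Prod>j<n - i. fe_coeff q l (Suc (i + j)))"
        using act_e_power[of "n - i" i 1] True unfolding e1 by simp
      also have "(\<Prod>j<n - i. fe_coeff q l (Suc (i + j))) = (\<Prod>k\<in>{i..<n}. fe_coeff q l (Suc k))"
        using prod.shift_bounds_nat_ivl[of "\<lambda>k. fe_coeff q l (Suc k)" 0 i "n - i"] True
        by (simp add: add.commute lessThan_atLeast0)
      finally show ?thesis
        using nz True Inl by (simp add: e_coeff_def free_act_linear)
    next
      case False
      then show ?thesis
        using Inl act_casimir(2)[of 0] by (simp add: nilp_def free_act_linear free_act_mult act_f_power)
    qed
  qed (simp add: act_f_power free_act_linear)
qed (simp add: free_act_linear)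

lemma act_eq_0_imp: "act x cyclic = 0 \<Longrightarrow> x \<in> J"
  using eqv_lift[of x] by (simp add: eqv_def)

end

section \<open>Quotients by left ideals\<close>

lemma left_module_quotient:
  fixes R :: "'a ring"
  assumes "ring R" and I: "left_ideal I R"
  shows "left_module R (quotient_left_module R I)"
    and "x \<in> carrier R \<Longrightarrow> y \<in> carrier R \<Longrightarrow>
      (I +>\<^bsub>R\<^esub> x) \<oplus>\<^bsub>quotient_left_module R I\<^esub> (I +>\<^bsub>R\<^esub> y) = I +>\<^bsub>R\<^esub> (x \<oplus>\<^bsub>R\<^esub> y)"
    and "r \<in> carrier R \<Longrightarrow> x \<in> carrier R \<Longrightarrow>
      r \<odot>\<^bsub>quotient_left_module R I\<^esub> (I +>\<^bsub>R\<^esub> x) = I +>\<^bsub>R\<^esub> (r \<otimes>\<^bsub>R\<^esub> x)"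
proof -
  interpret ring R by fact
  interpret abelian_subgroup I R
    using I by (intro abelian_subgroupI3 abelian_group_axioms) (simp add: left_ideal_def)
  let ?Q = "quotient_left_module R I"
  show add: "(I +>\<^bsub>R\<^esub> x) \<oplus>\<^bsub>?Q\<^esub> (I +>\<^bsub>R\<^esub> y) = I +>\<^bsub>R\<^esub> (x \<oplus>\<^bsub>R\<^esub> y)"
    if "x \<in> carrier R" "y \<in> carrier R" for x y
    using a_rcos_sum[OF that] by (simp add: quotient_left_module_def)
  show smult: "r \<odot>\<^bsub>?Q\<^esub> (I +>\<^bsub>R\<^esub> x) = I +>\<^bsub>R\<^esub> (r \<otimes>\<^bsub>R\<^esub> x)"
    if r: "r \<in> carrier R" and x: "x \<in> carrier R" for r x
  proof -
    \<comment> \<open>Scalar multiplication on the quotient is a union over representatives. All its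
      members coincide because I is stable under left multiplication.\<close>
    have eq: "I +>\<^bsub>R\<^esub> (r \<otimes>\<^bsub>R\<^esub> y) = I +>\<^bsub>R\<^esub> (r \<otimes>\<^bsub>R\<^esub> x)" if "y \<in> I +>\<^bsub>R\<^esub> x" for y
    proof -
      obtain i where i: "i \<in> I" "y = i \<oplus>\<^bsub>R\<^esub> x"
        using \<open>y \<in> I +>\<^bsub>R\<^esub> x\<close> by (auto simp: a_r_coset_def')
      have "r \<otimes>\<^bsub>R\<^esub> y = (r \<otimes>\<^bsub>R\<^esub> i) \<oplus>\<^bsub>R\<^esub> (r \<otimes>\<^bsub>R\<^esub> x)"
        using i r x a_subset by (auto simp: r_distr)
      moreover have "r \<otimes>\<^bsub>R\<^esub> i \<in> I"
        using I i(1) r by (simp add: left_ideal_def)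
      ultimately have "r \<otimes>\<^bsub>R\<^esub> y \<in> I +>\<^bsub>R\<^esub> (r \<otimes>\<^bsub>R\<^esub> x)"
        by (auto simp: a_r_coset_def')
      then show ?thesis
        by (rule a_repr_independence[symmetric]) (use r x a_subgroup in auto)
    qed
    have "r \<odot>\<^bsub>?Q\<^esub> (I +>\<^bsub>R\<^esub> x) = (\<Union>y\<in>I +>\<^bsub>R\<^esub> x. I +>\<^bsub>R\<^esub> (r \<otimes>\<^bsub>R\<^esub> y))"
      by (simp add: quotient_left_module_def)
    also have "\<dots> = (\<Union>y\<in>I +>\<^bsub>R\<^esub> x. I +>\<^bsub>R\<^esub> (r \<otimes>\<^bsub>R\<^esub> x))"
      by (rule SUP_cong[OF refl eq])
    also have "\<dots> = I +>\<^bsub>R\<^esub> (r \<otimes>\<^bsub>R\<^esub> x)"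
      using a_rcos_self[OF x] by (metis SUP_const empty_iff)
    finally show ?thesis .
  qed
  \<comment> \<open>The ring as left module over itself; the quotient is its image under the coset
    map.\<close>
  let ?M = "\<lparr>carrier = carrier R, monoid.mult = undefined, one = undefined,
      ring.zero = \<zero>\<^bsub>R\<^esub>, add = (\<oplus>\<^bsub>R\<^esub>), smult = (\<otimes>\<^bsub>R\<^esub>)\<rparr>"
  have "left_module R ?M"
  proof -
    have "abelian_group ?M"
      by (rule abelian_groupI) (auto simp: a_ac intro: l_neg)
    then show ?thesis
      using ring_axioms by (simp add: left_module_def left_module_axioms_def l_distr r_distr m_assoc)
  qed
  then show "left_module R ?Q"
  proof (rule left_module_image[where h = "\<lambda>x. I +>\<^bsub>R\<^esub> x"])
    show "(\<lambda>x. I +>\<^bsub>R\<^esub> x) ` carrier ?M = carrier ?Q"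
      by (auto simp: quotient_left_module_def A_RCOSETS_def')
    show "I +>\<^bsub>R\<^esub> \<zero>\<^bsub>?M\<^esub> = \<zero>\<^bsub>?Q\<^esub>"
      using a_coset_add_zero[OF a_subset] by (simp add: quotient_left_module_def)
  qed (simp_all add: add smult)
qed

section \<open>Generated left ideals and classes in U_q\<close>

lemma left_ideal_gen_left_ideal:
  assumes "ring R" "S \<subseteq> carrier R"
  shows "left_ideal (gen_left_ideal R S) R"
proof -
  interpret ring R by fact
  let ?F = "{I. left_ideal I R \<and> S \<subseteq> I}"
  have "left_ideal (carrier R) R"
    by (auto simp: left_ideal_def intro!: additive_subgroup.intro add.subgroup_self)
  then have F: "?F \<noteq> {}"
    using assms by blast
  have "additive_subgroup (\<Inter>?F) R"
    using F by (intro additive_subgroup.intro add.subgroups_Inter)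
      (auto simp: left_ideal_def additive_subgroup_def)
  then show ?thesis
    by (auto simp: gen_left_ideal_def left_ideal_def)
qed

lemma gen_left_ideal_superset: "S \<subseteq> gen_left_ideal R S"
  by (auto simp: gen_left_ideal_def)

lemma gen_left_ideal_minimal: "left_ideal I R \<Longrightarrow> S \<subseteq> I \<Longrightarrow> gen_left_ideal R S \<subseteq> I"
  by (auto simp: gen_left_ideal_def)

lemma uq_class_eq_iff: "uq_class q x = uq_class q y \<longleftrightarrow> x - y \<in> uq_ideal q"
proof
  assume "uq_class q x = uq_class q y"
  moreover have "x \<in> uq_class q x"
    using uq_ideal_closed(1) by (force simp: uq_class_altdef)
  ultimately show "x - y \<in> uq_ideal q"
    by (auto simp: uq_class_altdef)
next
  have *: "uq_class q x \<subseteq> uq_class q y" if "x - y \<in> uq_ideal q" for x y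
  proof
    fix z assume "z \<in> uq_class q x"
    then obtain w where "w \<in> uq_ideal q" "z = w + x"
      by (auto simp: uq_class_altdef)
    then have "z = (w + (x - y)) + y" "w + (x - y) \<in> uq_ideal q"
      using that by (auto intro: uq_ideal_closed)
    then show "z \<in> uq_class q y"
      unfolding uq_class_altdef by blast
  qed
  assume "x - y \<in> uq_ideal q"
  then show "uq_class q x = uq_class q y"
    using *[of x y] *[of y x] uq_ideal_closed(3)[of "x - y" q] by auto
qed

lemma zero_Uq: "\<zero>\<^bsub>Uq q\<^esub> = uq_class q 0"
  by (auto simp: Uq_def FactRing_def uq_class_altdef)

lemma a_inv_Uq: "\<ominus>\<^bsub>Uq q\<^esub> uq_class q x = uq_class q (- x)"
  by (rule abelian_group.minus_equality[OF ring.is_abelian_group[OF ring_Uq]])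
    (auto simp: Uq_class_simps carrier_Uq zero_Uq)

text \<open>Used to bound the T ideal from above by the image of an annihilator computed in the free
  algebra.\<close>

lemma left_ideal_uq_class_image:
  assumes "0 \<in> K" "\<And>x y. x \<in> K \<Longrightarrow> y \<in> K \<Longrightarrow> x + y \<in> K" "\<And>x y. x \<in> K \<Longrightarrow> y * x \<in> K"
  shows "left_ideal (uq_class q ` K) (Uq q)"
proof -
  interpret ring "Uq q" by (rule ring_Uq)
  have "subgroup (uq_class q ` K) (add_monoid (Uq q))"
  proof (rule add.subgroupI)
    show "a_inv (Uq q) a \<in> uq_class q ` K" if "a \<in> uq_class q ` K" for a
      using that assms(3)[of _ "-1"] by (auto simp: a_inv_Uq)
  qed (use assms in \<open>auto simp: carrier_Uq Uq_class_simps\<close>)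
  then show ?thesis
    using assms(3) by (auto simp: left_ideal_def additive_subgroup_def carrier_Uq Uq_class_simps)
qed

section \<open>Self-duality of T modules\<close>

context T_params
begin

definition sing_norm :: "nat \<Rightarrow> 'k" where
  "sing_norm i = (\<Prod>k<i. fe_coeff q l (Suc k))"

text \<open>The pairing of \<open>Inl (Suc (n + j))\<close> with \<open>Inr j\<close>. The initial
  value is forced by moving e from \<open>Inr 0\<close> to f on \<open>Inl n\<close>.\<close>

primrec off_diag :: "nat \<Rightarrow> 'k" where
  "off_diag 0 = sing_norm n"
| "off_diag (Suc j) = fe_coeff q l (Suc (Suc (n + j))) * off_diag j"

text \<open>The recursion is forced by moving f off \<open>Inr (Suc j)\<close>; the value at 0 is a
  free choice.\<close>

primrec diag :: "nat \<Rightarrow> 'k" where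
  "diag 0 = 0"
| "diag (Suc j) = fe_coeff q l (Suc (Suc (n + j))) * diag j + off_diag j"

text \<open>On the span of \<open>Inr j\<close> and \<open>Inl (Suc (n + j))\<close>, viewed as 1
  and \<nu>, this is tr(g x y) with g = \<open>off_diag j\<close> + \<open>diag j\<close> \<nu>, a
  unit since \<open>off_diag j\<close> is nonzero.\<close>

fun T_form :: "nat + nat \<Rightarrow> nat + nat \<Rightarrow> 'k" where
  "T_form (Inl i) (Inl k) = (if i = k \<and> i \<le> n then sing_norm i else 0)"
| "T_form (Inl i) (Inr j) = (if i = Suc (n + j) then off_diag j else 0)"
| "T_form (Inr j) (Inl i) = (if i = Suc (n + j) then off_diag j else 0)"
| "T_form (Inr j) (Inr k) = (if j = k then diag j else 0)"

text \<open>The inverse of the Gram matrix: entrywise up to \<open>n\<close>, and beyond that by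
  inverting 2 by 2 blocks with one zero diagonal entry.\<close>

fun T_dual_basis :: "nat + nat \<Rightarrow> (nat + nat \<Rightarrow>\<^sub>0 'k)" where
  "T_dual_basis (Inl i) = (if i \<le> n then Poly_Mapping.single (Inl i) (inverse (sing_norm i))
     else let j = i - Suc n in Poly_Mapping.single (Inr j) (inverse (off_diag j))
       + Poly_Mapping.single (Inl i) (- diag j / (off_diag j)\<^sup>2))"
| "T_dual_basis (Inr j) = Poly_Mapping.single (Inl (Suc (n + j))) (inverse (off_diag j))"

lemma sing_norm_nonzero: "i \<le> n \<Longrightarrow> sing_norm i \<noteq> 0"
  by (auto simp: sing_norm_def fe_coeff_eq_0_iff)

lemma off_diag_nonzero: "off_diag j \<noteq> 0"
  by (induction j) (simp_all add: sing_norm_nonzero fe_coeff_eq_0_iff)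

lemma T_form_contravariant:
  "pm_dot (T_gen q l n Gen_e b) (T_form c) = pm_dot (T_gen q l n Gen_f c) (T_form b)"
proof (cases b)
  case (Inl i)
  show ?thesis
  proof (cases c)
    case (Inl k)
    \<comment> \<open>Cutting the norms off after \<open>n\<close> is consistent with
      contravariance, since the norm at \<open>Suc n\<close> would contain this vanishing
      factor.\<close>
    have "k \<le> n \<Longrightarrow> \<not> Suc k \<le> n \<Longrightarrow> fe_coeff q l (Suc k) = 0"
      by (simp add: fe_coeff_eq_0_iff)
    then show ?thesis
      using Inl \<open>b = Inl i\<close> by (cases i) (auto simp: sing_norm_def)
  next
    case (Inr k)
    then show ?thesis
      using Inl by (cases i) auto
  qed
next
  case (Inr j)
  then show ?thesis
    by (cases c; cases j) (auto simp: pm_dot_add fe_coeff_eq_0_iff)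
qed

lemma T_dual_basis:
  "pm_dot (T_dual_basis b) (T_form c) = (if b = c then 1 else 0)"
  using sing_norm_nonzero off_diag_nonzero
  by (cases b; cases c) (auto simp: pm_dot_add Let_def power2_eq_square, simp add: divide_inverse mult.commute)

end

section \<open>Identification of T(n,\<epsilon>) with the model\<close>

lemma T_module_self_dual:
  fixes q :: "'k::field"
  assumes q: "q \<noteq> 0" and q_not_root: "\<And>m::nat. m > 0 \<Longrightarrow> q ^ m \<noteq> 1"
    and \<epsilon>: "\<epsilon>\<^sup>2 = 1"
  shows "isomorphic_left_modules (Uq q) (sigma_dual q (T_module q n \<epsilon>)) (T_module q n \<epsilon>)"
proof -
  define l where "l = \<epsilon> * q ^ n"
  define I where "I = T_ideal q n \<epsilon>"
  define J where "J = {x. uq_class q x \<in> I}"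
  define \<tau> where "\<tau> x = I +>\<^bsub>Uq q\<^esub> uq_class q x" for x
  let ?S = "{uq_class q (gen Gen_t - const (\<epsilon> * q powi (- int n - 2))),
      uq_class q (gen Gen_e ^ (n + 2)), uq_class q ((casimir q - const (\<epsilon> * T_casimir_value q n))\<^sup>2)}"
  have \<epsilon>_inv: "inverse \<epsilon> = \<epsilon>"
    using \<epsilon> by (intro inverse_unique) (simp add: power2_eq_square)
  interpret T_params q l n
    using q q_not_root \<epsilon> by unfold_locales (simp_all add: l_def power_mult_distrib power_mult[symmetric] mult.commute)
  have weight: "\<epsilon> * q powi (- int n - 2) = verma_weight q l (Suc n)"
    using q by (simp add: l_def verma_weight_def power_int_diff power_int_minus field_simps
        flip: power_mult power_add) (simp add: mult_2_right power_add)
  have casimir: "\<epsilon> * T_casimir_value q n = casimir_value q l"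
  proof -
    have "q powi (int n + 1) = q * q ^ n" "q powi (- int n - 1) = inverse (q * q ^ n)"
      using q by (simp_all add: power_int_add power_int_diff power_int_minus divide_inverse mult.commute)
    then show ?thesis
      by (simp add: T_casimir_value_def casimir_value_def l_def \<epsilon>_inv algebra_simps)
  qed
  have S: "?S \<subseteq> I"
    unfolding I_def T_ideal_def by (rule gen_left_ideal_superset)
  have I: "left_ideal I (Uq q)"
    unfolding I_def T_ideal_def by (rule left_ideal_gen_left_ideal[OF ring_Uq]) (auto simp: carrier_Uq)
  then have I_add: "additive_subgroup I (Uq q)"
    by (simp add: left_ideal_def)
  interpret abelian_subgroup I "Uq q"
    by (rule abelian_subgroupI3[OF I_add ring.is_abelian_group[OF ring_Uq]])
  interpret uq_left_ideal q J
  proof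
    show "x + y \<in> J" if "x \<in> J" "y \<in> J" for x y
      using that additive_subgroup.a_closed[OF I_add, of "uq_class q x" "uq_class q y"] by (simp add: J_def Uq_class_simps)
    show "y * x \<in> J" if "x \<in> J" for x y
      using that I by (auto simp: J_def left_ideal_def carrier_Uq simp flip: Uq_class_simps)
    show "uq_ideal q \<subseteq> J"
    proof
      fix x assume "x \<in> uq_ideal q"
      then have "uq_class q x = \<zero>\<^bsub>Uq q\<^esub>"
        by (simp add: zero_Uq uq_class_eq_iff)
      then show "x \<in> J"
        using additive_subgroup.zero_closed[OF I_add] by (simp add: J_def)
    qed
  qed (use q q_not_root in auto)
  interpret T_ideal_params q l n J
  proof
    have "gen Gen_t - const (verma_weight q l (Suc n)) \<in> J"
      using S by (simp add: J_def weight)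
    then show "has_weight 1 (verma_weight q l (Suc n))"
      using verma_weight_nonzero[OF q l_nonzero] const_mult(2)[of 1 "verma_weight q l (Suc n)"]
      by (simp add: has_weight_def eqv_def)
    have "gen Gen_e ^ Suc (Suc n) \<in> J" "nilp l * nilp l \<in> J"
      using S by (simp_all add: J_def casimir nilp_def power2_eq_square)
    then show "eqv (gen Gen_e ^ Suc (Suc n)) 0" "eqv (nilp l * nilp l) 0"
      by (simp_all add: eqv_def)
  qed
  \<comment> \<open>The bound on \<open>J\<close> from above: the annihilator of the cyclic vector
    is a left ideal containing the three generators.\<close>
  have act_J: "act x cyclic = 0" if "x \<in> J" for x
  proof -
    let ?K = "{x. act x cyclic = 0}"
    have fe: "fe_coeff q l (Suc n) = 0"
      by (simp add: fe_coeff_eq_0_iff)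
    \<comment> \<open>The rightmost e moves \<open>cyclic\<close> to \<open>Inl n\<close>, the next
      \<open>n\<close> lead to a multiple of \<open>Inl 0\<close>, and the last one kills
      it.\<close>
    have e_power: "gen Gen_e ^ (n + 2) = gen Gen_e * (gen Gen_e ^ n * gen Gen_e)"
      by (simp flip: power_Suc2)
    have "act (gen Gen_e ^ (n + 2)) cyclic = 0"
      unfolding e_power using fe act_e_power[of n 0] by (simp add: free_act_mult)
    moreover have "act (gen Gen_t - const (\<epsilon> * q powi (- int n - 2))) cyclic = 0"
      by (simp add: weight free_act_linear)
    moreover have "act ((casimir q - const (\<epsilon> * T_casimir_value q n))\<^sup>2) cyclic = 0"
      by (simp add: casimir power2_eq_square free_act_mult act_casimir)
    ultimately have "?S \<subseteq> uq_class q ` ?K"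
      by blast
    moreover have "left_ideal (uq_class q ` ?K) (Uq q)"
      by (rule left_ideal_uq_class_image) (simp_all add: free_act_linear free_act_mult)
    ultimately have "I \<subseteq> uq_class q ` ?K"
      unfolding I_def T_ideal_def by (intro gen_left_ideal_minimal)
    with that obtain y where "act y cyclic = 0" "x - y \<in> uq_ideal q"
      by (auto simp: J_def uq_class_eq_iff)
    then show ?thesis
      using act_uq_ideal[of "x - y" cyclic] by (simp add: free_act_linear)
  qed
  have cls: "uq_class q x \<in> carrier (Uq q)" for x
    by (simp add: carrier_Uq)
  \<comment> \<open>Both bounds together: the kernel of the action on \<open>cyclic\<close> is
    exactly \<open>J\<close>, so the coordinates \<open>\<pi>\<close> do not depend on the
    representative picked by \<open>SOME\<close>.\<close>
  have \<tau>_eq_iff: "\<tau> x = \<tau> y \<longleftrightarrow> act x cyclic = act y cyclic" for x y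
  proof -
    have "\<tau> x = \<tau> y \<longleftrightarrow> uq_class q x \<oplus>\<^bsub>Uq q\<^esub> (\<ominus>\<^bsub>Uq q\<^esub> uq_class q y) \<in> I"
    proof
      assume "\<tau> x = \<tau> y"
      then show "uq_class q x \<oplus>\<^bsub>Uq q\<^esub> (\<ominus>\<^bsub>Uq q\<^esub> uq_class q y) \<in> I"
        using a_rcos_self[OF cls, of x] a_rcos_module[OF cls cls] by (simp add: \<tau>_def)
    next
      assume "uq_class q x \<oplus>\<^bsub>Uq q\<^esub> (\<ominus>\<^bsub>Uq q\<^esub> uq_class q y) \<in> I"
      then show "\<tau> x = \<tau> y"
        unfolding \<tau>_def
        by (intro a_repr_independence[symmetric, OF _ cls a_subgroup] a_rcos_module[OF cls cls, THEN iffD2])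
    qed
    also have "\<dots> \<longleftrightarrow> x - y \<in> J"
      by (simp add: J_def a_inv_Uq Uq_class_simps)
    also have "\<dots> \<longleftrightarrow> act x cyclic = act y cyclic"
      using act_J[of "x - y"] act_eq_0_imp[of "x - y"] by (auto simp: free_act_linear)
    finally show ?thesis .
  qed
  define \<pi> where "\<pi> A = act (SOME x. \<tau> x = A) cyclic" for A
  have \<pi>_\<tau>: "\<pi> (\<tau> x) = act x cyclic" for x
    unfolding \<pi>_def \<tau>_eq_iff by (rule someI) (rule refl)
  let ?T = "T_module q n \<epsilon>"
  have T: "left_module (Uq q) ?T" "\<tau> x \<oplus>\<^bsub>?T\<^esub> \<tau> y = \<tau> (x + y)"
    "uq_class q x \<odot>\<^bsub>?T\<^esub> \<tau> y = \<tau> (x * y)" for x y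
    using left_module_quotient[OF ring_Uq I] cls
    by (simp_all add: T_module_def I_def \<tau>_def flip: Uq_class_simps)
  have carrier: "carrier ?T = range \<tau>"
    by (auto simp: T_module_def quotient_left_module_def A_RCOSETS_def' \<tau>_def I_def carrier_Uq)
  show ?thesis
  proof (rule self_dual_if_contravariant_form[where \<pi> = \<pi> and \<rho> = "T_gen q l n" and wt = "T_weight q l n"
        and b = T_form and \<gamma> = T_dual_basis])
    show "bij_betw \<pi> (carrier ?T) UNIV"
      unfolding bij_betw_def
    proof
      show "inj_on \<pi> (carrier ?T)"
        by (simp add: inj_on_def carrier \<tau>_eq_iff \<pi>_\<tau>)
      show "\<pi> ` carrier ?T = UNIV"
      proof (intro equalityI subsetI)
        fix p
        have "p = \<pi> (\<tau> (lift p))"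
          by (simp add: \<pi>_\<tau> act_lift)
        then show "p \<in> \<pi> ` carrier ?T"
          unfolding carrier by (rule image_eqI) (rule rangeI)
      qed simp
    qed
    show "T_form b c = T_form c b" for b c
      by (cases b; cases c) auto
    show "T_weight q l n b = T_weight q l n c" if "T_form b c \<noteq> 0" for b c
      using that by (cases b; cases c) (auto split: if_splits)
    show "\<pi> (A \<oplus>\<^bsub>?T\<^esub> A') = \<pi> A + \<pi> A'" if "A \<in> carrier ?T" "A' \<in> carrier ?T" for A A'
      using that by (auto simp: carrier T(2) \<pi>_\<tau> free_act_linear)
    show "\<pi> (uq_class q (const c) \<odot>\<^bsub>?T\<^esub> A) = pm_scale c (\<pi> A)" if "A \<in> carrier ?T" for c A
      using that by (auto simp: carrier T(3) \<pi>_\<tau> free_act_mult)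
    show "\<pi> (uq_class q (gen g) \<odot>\<^bsub>?T\<^esub> A) = pm_extend (T_gen q l n g) (\<pi> A)" if "A \<in> carrier ?T" for g A
      using that by (auto simp: carrier T(3) \<pi>_\<tau> free_act_mult)
  qed (simp_all only: q T(1) T_form_contravariant T_dual_basis T_weight_nonzero finite_T_weight T_gen.simps
      not_False_eq_True)
qed

theorem theorem2:
  fixes q :: "'k::field"
  assumes "CHAR('k) \<noteq> 2" and "CHAR('k) \<noteq> 3"
    and "q \<noteq> 0" and "\<forall>m::nat. m > 0 \<longrightarrow> q ^ m \<noteq> 1"
  shows "(\<forall>l::'k. l \<noteq> 0 \<and> (\<forall>n::nat. \<forall>\<epsilon>\<in>{1, -1}. l \<noteq> \<epsilon> * q ^ n) \<longrightarrow>
            isomorphic_left_modules (Uq q) (sigma_dual q (verma q l)) (verma q l)) \<and>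
         (\<forall>n::nat. \<forall>\<epsilon>\<in>{1, -1}.
            isomorphic_left_modules (Uq q) (sigma_dual q (T_module q n \<epsilon>)) (T_module q n \<epsilon>))"
proof (intro conjI allI impI ballI)
  fix l :: 'k assume "l \<noteq> 0 \<and> (\<forall>n::nat. \<forall>\<epsilon>\<in>{1, -1}. l \<noteq> \<epsilon> * q ^ n)"
  then show "isomorphic_left_modules (Uq q) (sigma_dual q (verma q l)) (verma q l)"
    using assms(3,4) by (intro verma_self_dual) auto
next
  fix n :: nat and \<epsilon> :: 'k assume "\<epsilon> \<in> {1, -1}"
  then show "isomorphic_left_modules (Uq q) (sigma_dual q (T_module q n \<epsilon>)) (T_module q n \<epsilon>)"
    using assms(3,4) by (intro T_module_self_dual) auto
qed

end
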